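(* Let $n>m\geq 1$ be integers and let $A$ be a commutative Noetherian $\mathbb{Z}[\frac1p,\zeta_p]$-algebra with $0\neq 1$. Let $(\pi,V)$ be an $A[G_n]$-module and $(\pi',V')$ an $A[G_m]$-module, both of Whittaker type, and suppose that $\pi'$ is not exceptional for $\pi$. Then there exists a unique element $\gamma(\pi\times\pi',\psi)\in A^{\times}$ such that \[ \Big(\sum_{x\in N_m\backslash G_m}W\begin{pmatrix}x & 0\\ 0 & I_{n-m}\end{pmatrix}W'(x)\Big)\gamma(\pi\times \pi',\psi) = \sum_{x\in N_m\backslash G_m}\ \sum_{y\in \mathrm{Mat}_{m, n-m-1}(\mathbb{F}_q)}W\begin{pmatrix}0 & 1 &0\\ 0&0 & I_{n-m-1}\\ x &0 & y\end{pmatrix}W'(x) \] for all $W\in \mathcal{W}(V,\psi_A)$ and all $W'\in \mathcal{W}(V',\psi_A^{-1})$. (In the block matrix on the right, the block rows have heights $1,\,n-m-1,\,m$ and the block columns have widths $m,\,1,\,n-m-1$.)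
   Context: Let $p$ be a prime, $q$ a power of $p$, $\mathbb{F}_q$ the field with $q$ elements, $G_n=\mathrm{GL}_n(\mathbb{F}_q)$, and $\zeta_p$ a primitive $p$-th root of unity. Fix a nontrivial homomorphism $\psi:(\mathbb{F}_q,+)\to \mathbb{Z}[\frac1p,\zeta_p]^{\times}$ and let $\psi_A$ be its composite with the structure map to $A^\times$. Let $N_n\subset G_n$ be the upper triangular unipotent matrices; regard $\psi_A$ as a character of $N_n$ via $\psi_A(u)=\psi_A(\sum_{i=1}^{n-1}u_{i,i+1})$. Let $P_n\subset G_n$ be the mirabolic subgroup (matrices with last row $(0,\dots,0,1)$) and $U_n=\{\begin{psmallmatrix}I_{n-1}&y\\0&1\end{psmallmatrix}\}$, on which $\psi_A\begin{psmallmatrix}I_{n-1}&y\\0&1\end{psmallmatrix}=\psi_A(y_{n-1})$; $G_{n-1}$ and $P_{n-1}$ are embedded in $P_n$ in the top left corner. For an $A[P_n]$-module $V$ let $\Phi^-(V)=V/\langle uv-\psi_A(u)v: u\in U_n,v\in V\rangle$ (an $A[P_{n-1}]$-module) and $\Psi^-(V)=V/\langle uv-v:u\in U_n, v\in V\rangle$ (an $A[G_{n-1}]$-module). For $1\le k\le n$ the $k$-th derivative is $V^{(k)}=\Psi^-(\Phi^-)^{k-1}(V)$, an $A[G_{n-k}]$-module; for an $A[G_n]$-module it is the derivative of its restriction to $P_n$, and $V^{(0)}=V$. The top derivative $V^{(n)}$ is isomorphic to the $(N_n,\psi_A)$-coinvariants of $V$. An $A[G_n]$-module $V$ is of Whittaker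 type if $V^{(n)}$ is a free $A$-module of rank one. For such $V$, choosing a generator $\lambda$ of $\mathrm{Hom}_A(V^{(n)},A)$ gives a map $V\to \mathrm{Ind}_{N_n}^{G_n}\psi_A=\{f:G_n\to A: f(ug)=\psi_A(u)f(g)\}$, $v\mapsto (g\mapsto \lambda(\overline{gv}))$; its image $\mathcal{W}(V,\psi_A)$ (independent of $\lambda$) is the Whittaker model. The same constructions with $\psi_A^{-1}$ in place of $\psi_A$ give derivatives with respect to $\psi_A^{-1}$ and the Whittaker model $\mathcal{W}(V',\psi_A^{-1})\subset\mathrm{Ind}_{N_m}^{G_m}\psi_A^{-1}$ (the $(N_m,\psi_A^{-1})$-coinvariants of a Whittaker type module are also free of rank one). The module $\pi'$ is exceptional for $\pi$ if there is $t\in\{1,\dots,m\}$ with $\mathrm{Hom}_{A[G_t]}\big(\mathcal{W}(V,\psi_A)^{(n-t)}\otimes_A\mathcal{W}(V',\psi_A^{-1})^{(m-t)},\mathbf{1}\big)\neq 0$, i.e. there is a nonzero $G_t$-invariant $A$-bilinear form on these derivatives ($G_t$ acting diagonally; derivatives of $\mathcal{W}(V',\psi_A^{-1})$ taken with respect to $\psi_A^{-1}$). *)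

theory Defs
  imports "Jordan_Normal_Form.Determinant" "HOL-Library.Function_Algebras"
begin

definition noetherian_ring :: "'a::comm_ring_1 itself \<Rightarrow> bool" where
  "noetherian_ring _ \<longleftrightarrow>
     (\<forall>I::'a set. Modules.module.subspace ((*) :: 'a \<Rightarrow> 'a \<Rightarrow> 'a) I \<longrightarrow>
        (\<exists>F. finite F \<and> I = Modules.module.span ((*) :: 'a \<Rightarrow> 'a \<Rightarrow> 'a) F))"

text \<open>A structure of Z[1/p, zeta_p]-algebra on A: p is invertible in A and
  zeta (the image of zeta_p) is a root of the p-th cyclotomic polynomial.\<close>
definition Zp_zeta_algebra :: "nat \<Rightarrow> 'a::comm_ring_1 \<Rightarrow> bool" where
  "Zp_zeta_algebra p \<zeta> \<longleftrightarrow> (\<exists>u::'a. of_nat p * u = 1) \<and> (\<Sum>i<p. \<zeta> ^ i) = 0"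

text \<open>The additive character psi_A: F_q -> A^x.  The nontrivial character
  psi : F_q -> Z[1/p,zeta_p]^x has the form x |-> zeta_p^(kk x) with
  kk : F_q -> Z/p a nontrivial additive map; its composite with the structure
  map (zeta_p |-> zeta) is psi_A.\<close>
definition additive_mod :: "nat \<Rightarrow> ('k::field \<Rightarrow> nat) \<Rightarrow> bool" where
  "additive_mod p kk \<longleftrightarrow> (\<forall>x y. kk (x + y) mod p = (kk x + kk y) mod p) \<and> (\<exists>x. kk x mod p \<noteq> 0)"

definition psiA :: "'a::comm_ring_1 \<Rightarrow> ('k \<Rightarrow> nat) \<Rightarrow> 'k \<Rightarrow> 'a" where
  "psiA \<zeta> kk x = \<zeta> ^ kk x"

definition psi_inv :: "('k::ab_group_add \<Rightarrow> 'a) \<Rightarrow> 'k \<Rightarrow> 'a" where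
  "psi_inv chi x = chi (- x)"

definition GL :: "nat \<Rightarrow> 'k::field mat set" where
  "GL n = {g \<in> carrier_mat n n. det g \<noteq> 0}"

definition N_grp :: "nat \<Rightarrow> 'k::field mat set" where
  "N_grp n = {u \<in> carrier_mat n n. (\<forall>i<n. u $$ (i,i) = 1) \<and> (\<forall>i<n. \<forall>j<i. u $$ (i,j) = 0)}"

definition U_grp :: "nat \<Rightarrow> 'k::field mat set" where
  "U_grp r = {u \<in> carrier_mat r r. (\<forall>i<r. \<forall>j<r. j \<noteq> r - 1 \<longrightarrow> u $$ (i,j) = (if i = j then 1 else 0))
                                   \<and> u $$ (r - 1, r - 1) = 1}"

text \<open>The character on U_r: u |-> chi(y_{r-1}) (only used for r >= 2).\<close>
definition psiU :: "('k::field \<Rightarrow> 'a::comm_ring_1) \<Rightarrow> nat \<Rightarrow> 'k mat \<Rightarrow> 'a" where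
  "psiU chi r u = (if 2 \<le> r then chi (u $$ (r - 2, r - 1)) else 1)"

definition embed_tl :: "nat \<Rightarrow> 'k::field mat \<Rightarrow> 'k mat" where
  "embed_tl n g = mat n n (\<lambda>(i,j). if i < dim_row g \<and> j < dim_col g then g $$ (i,j)
                                 else if i = j then 1 else 0)"

text \<open>An A[G_n]-module structure on the type 'v: an A-module with an A-linear
  action of GL_n(F_q) (the action on non-invertible matrices is irrelevant).\<close>
definition GL_module :: "nat \<Rightarrow> ('a::comm_ring_1 \<Rightarrow> 'v::ab_group_add \<Rightarrow> 'v) \<Rightarrow> ('k::field mat \<Rightarrow> 'v \<Rightarrow> 'v) \<Rightarrow> bool" where
  "GL_module n sc act \<longleftrightarrow> Modules.module sc
     \<and> (\<forall>g\<in>GL n. \<forall>h\<in>GL n. \<forall>v. act (g * h) v = act g (act h v))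
     \<and> (\<forall>v. act (1\<^sub>m n) v = v)
     \<and> (\<forall>g\<in>GL n. \<forall>x y. act g (x + y) = act g x + act g y)
     \<and> (\<forall>g\<in>GL n. \<forall>a x. act g (sc a x) = sc a (act g x))"

text \<open>For a P_n-module M (a submodule of the ambient module 'v), the k-th derivative
  M^(k) = Psi^-(Phi^-)^(k-1)(M) is the quotient of M by the submodule returned here
  (k >= 1); for k = 0 the submodule is 0.  Iterating the quotients, the kernel is
  spanned by u v - chi(u) v for u in U_{n-j} (j < k-1), and u v - v for u in U_{n-k+1},
  all groups embedded in the top left corner of G_n.  The group G_{n-k}, embedded in
  the top left corner, acts on the quotient.\<close>
definition deriv_kernel ::
  "('a::comm_ring_1 \<Rightarrow> 'v::ab_group_add \<Rightarrow> 'v) \<Rightarrow> ('k::field mat \<Rightarrow> 'v \<Rightarrow> 'v) \<Rightarrow> ('k \<Rightarrow> 'a)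
    \<Rightarrow> nat \<Rightarrow> nat \<Rightarrow> 'v set \<Rightarrow> 'v set" where
  "deriv_kernel sc act chi n k M =
     (if k = 0 then {0} else
      Modules.module.span sc
        ({act (embed_tl n u) v - sc (psiU chi (n - j) u) v | j u v. j + 1 < k \<and> u \<in> U_grp (n - j) \<and> v \<in> M}
         \<union> {act (embed_tl n u) v - v | u v. u \<in> U_grp (n - k + 1) \<and> v \<in> M}))"

text \<open>A generator lambda of Hom_A(V^(n), A), where V^(n) is free of rank one,
  is the same as an A-linear surjection l : V -> A whose kernel is exactly the
  kernel of V -> V^(n).\<close>
definition whittaker_functional ::
  "nat \<Rightarrow> ('a::comm_ring_1 \<Rightarrow> 'v::ab_group_add \<Rightarrow> 'v) \<Rightarrow> ('k::field mat \<Rightarrow> 'v \<Rightarrow> 'v) \<Rightarrow> ('k \<Rightarrow> 'a)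
     \<Rightarrow> ('v \<Rightarrow> 'a) \<Rightarrow> bool" where
  "whittaker_functional n sc act chi l \<longleftrightarrow>
     (\<forall>x y. l (x + y) = l x + l y) \<and> (\<forall>a x. l (sc a x) = a * l x) \<and> surj l
     \<and> {v. l v = 0} = deriv_kernel sc act chi n n UNIV"

text \<open>Whittaker type: V^(n) is a free A-module of rank one.\<close>
definition whittaker_type ::
  "nat \<Rightarrow> ('a::comm_ring_1 \<Rightarrow> 'v::ab_group_add \<Rightarrow> 'v) \<Rightarrow> ('k::field mat \<Rightarrow> 'v \<Rightarrow> 'v) \<Rightarrow> ('k \<Rightarrow> 'a) \<Rightarrow> bool" where
  "whittaker_type n sc act chi \<longleftrightarrow> (\<exists>l. whittaker_functional n sc act chi l)"

text \<open>Functions G_n -> A are modelled as functions on all matrices, zero off GL_n.\<close>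
definition fscale :: "'a::comm_ring_1 \<Rightarrow> ('k mat \<Rightarrow> 'a) \<Rightarrow> ('k mat \<Rightarrow> 'a)" where
  "fscale a f = (\<lambda>h. a * f h)"

definition transl :: "nat \<Rightarrow> 'k::field mat \<Rightarrow> ('k mat \<Rightarrow> 'a::comm_ring_1) \<Rightarrow> ('k mat \<Rightarrow> 'a)" where
  "transl n g f = (\<lambda>h. if h \<in> GL n then f (h * g) else 0)"

definition whittaker_fun :: "nat \<Rightarrow> ('k::field mat \<Rightarrow> 'v \<Rightarrow> 'v) \<Rightarrow> ('v \<Rightarrow> 'a::comm_ring_1) \<Rightarrow> 'v \<Rightarrow> ('k mat \<Rightarrow> 'a)" where
  "whittaker_fun n act l v = (\<lambda>h. if h \<in> GL n then l (act h v) else 0)"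

definition whittaker_model :: "nat \<Rightarrow> ('k::field mat \<Rightarrow> 'v \<Rightarrow> 'v) \<Rightarrow> ('v \<Rightarrow> 'a::comm_ring_1) \<Rightarrow> ('k mat \<Rightarrow> 'a) set" where
  "whittaker_model n act l = range (whittaker_fun n act l)"

text \<open>pi' (Whittaker model W' in G_m, w.r.t. psi^-1) is exceptional for pi (Whittaker
  model W in G_n, w.r.t. psi): for some t in {1..m} there is a nonzero G_t-invariant
  A-bilinear form on W^(n-t) x W'^(m-t), i.e. an A-bilinear form on W x W' vanishing
  on the kernels of the quotient maps, invariant under diagonal G_t and not zero.\<close>
definition exceptional ::
  "nat \<Rightarrow> nat \<Rightarrow> ('k::field \<Rightarrow> 'a::comm_ring_1) \<Rightarrow> ('k mat \<Rightarrow> 'a) set \<Rightarrow> ('k mat \<Rightarrow> 'a) set \<Rightarrow> bool" where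
  "exceptional n m chi W W' \<longleftrightarrow>
     (\<exists>t\<in>{1..m}. \<exists>B :: ('k mat \<Rightarrow> 'a) \<Rightarrow> ('k mat \<Rightarrow> 'a) \<Rightarrow> 'a.
        (\<forall>f1\<in>W. \<forall>f2\<in>W. \<forall>g\<in>W'. B (f1 + f2) g = B f1 g + B f2 g)
      \<and> (\<forall>f\<in>W. \<forall>g1\<in>W'. \<forall>g2\<in>W'. B f (g1 + g2) = B f g1 + B f g2)
      \<and> (\<forall>a. \<forall>f\<in>W. \<forall>g\<in>W'. B (fscale a f) g = a * B f g \<and> B f (fscale a g) = a * B f g)
      \<and> (\<forall>f\<in>deriv_kernel fscale (transl n) chi n (n - t) W. \<forall>g\<in>W'. B f g = 0)
      \<and> (\<forall>f\<in>W. \<forall>g\<in>deriv_kernel fscale (transl m) (psi_inv chi) m (m - t) W'. B f g = 0)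
      \<and> (\<forall>h\<in>GL t. \<forall>f\<in>W. \<forall>g\<in>W'. B (transl n (embed_tl n h) f) (transl m (embed_tl m h) g) = B f g)
      \<and> (\<exists>f\<in>W. \<exists>g\<in>W'. B f g \<noteq> 0))"

definition right_cosets_N :: "nat \<Rightarrow> 'k::field mat set set" where
  "right_cosets_N m = {{u * x | u. u \<in> N_grp m} | x. x \<in> GL m}"

text \<open>Sum of a (left N_m-invariant) function over N_m \ G_m, via a representative of each coset.\<close>
definition sum_NG :: "nat \<Rightarrow> ('k::field mat \<Rightarrow> 'a::comm_ring_1) \<Rightarrow> 'a" where
  "sum_NG m F = (\<Sum>C\<in>right_cosets_N m. F (SOME x. x \<in> C))"

text \<open>The n x n matrix with block rows of heights 1, n-m-1, m and block columns of
  widths m, 1, n-m-1:  (0 1 0; 0 0 I_{n-m-1}; x 0 y).\<close>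
definition gamma_mat :: "nat \<Rightarrow> nat \<Rightarrow> 'k::field mat \<Rightarrow> 'k mat \<Rightarrow> 'k mat" where
  "gamma_mat n m x y = mat n n (\<lambda>(i,j).
      if i = 0 then (if j = m then 1 else 0)
      else if i < n - m then (if m < j \<and> j - m - 1 = i - 1 then 1 else 0)
      else if j < m then x $$ (i - (n - m), j)
      else if j = m then 0
      else y $$ (i - (n - m), j - m - 1))"

end

theory Submission
  imports Defs "HOL-Algebra.Sylow" "HOL-Algebra.Multiplicative_Group" "HOL-Library.Cardinality"
    "HOL-Number_Theory.Cong"
begin

text \<open>
  Both sides of the functional equation are \<open>G\<^sub>m\<close>-invariant bilinear forms on
  \<open>(\<Phi>\<^sup>-)\<^bsup>n-m-1\<^esup> W \<times> W'\<close>, so it suffices that the space of such forms is free of rank one,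
  spanned by the left-hand side, and that the right-hand side takes the value one.

  Rank one is shown by descent on \<open>t = m, \<dots>, 0\<close>. Composing a form with the projection of its first
  argument to the \<open>(U\<^bsub>t+1\<^esub>, \<psi>)\<close>-isotypic part yields a form at level \<open>t - 1\<close>. If the latter vanishes,
  then, since \<open>G\<^sub>t\<close> permutes the nontrivial characters of \<open>U\<^bsub>t+1\<^esub>\<close> transitively, the original form is
  \<open>U\<^bsub>t+1\<^esub>\<close>-invariant and factors through the derivatives \<open>W\<^bsup>(n-t)\<^esup> \<times> W'\<^bsup>(m-t)\<^esup>\<close>, where it is zero
  because \<open>\<pi>'\<close> is not exceptional. At level \<open>0\<close> a form is a multiple of \<open>f(1) g(1)\<close>.

  If \<open>f\<close> is the average of a Whittaker function over \<open>N\<^sub>n\<close> against \<open>\<psi>\<close>, the projections do not change it,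
  so a form \<open>B\<close> is determined by the single value \<open>B(f, g)\<close>. Such a Bessel function \<open>f\<close>, among the matrices
  whose last row (or whose first column) is the one of the identity, is supported on \<open>N\<^sub>n\<close>. Hence
  all but the trivial coset drop out of the left-hand side at \<open>f\<close>, and out of the right-hand side
  at a translate of \<open>f\<close>.
\<close>

section \<open>Orders of matrix groups over F_q, and why q is a unit of A\<close>

section \<open>Finite fields and finite matrix groups\<close>

lemma GL_mult: "g \<in> GL n \<Longrightarrow> h \<in> GL n \<Longrightarrow> g * h \<in> GL n"
  by (auto simp: GL_def det_mult)

lemma GL_carrier: "g \<in> GL n \<Longrightarrow> g \<in> carrier_mat n n"
  by (simp add: GL_def)

lemma GL_one [simp]: "1\<^sub>m n \<in> GL n"
  by (simp add: GL_def)

lemma GL_inverse: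
  assumes "g \<in> GL n"
  obtains h where "h \<in> GL n" "g * h = 1\<^sub>m n" "h * g = 1\<^sub>m n"
proof -
  obtain h where h: "h \<in> carrier_mat n n" "h * g = 1\<^sub>m n" "g * h = 1\<^sub>m n"
    using assms det_non_zero_imp_unit[of g n]
    by (auto simp: GL_def Units_def ring_mat_def)
  have "det h * det g = 1" using det_mult[of h n g] h assms by (simp add: GL_def)
  then have "h \<in> GL n" using h by (auto simp: GL_def)
  then show thesis using that h by blast
qed

lemma N_GL: "u \<in> N_grp n \<Longrightarrow> u \<in> GL n"
proof -
  assume u: "u \<in> N_grp n"
  then have c: "u \<in> carrier_mat n n" by (simp add: N_grp_def)
  have "upper_triangular u" using u by (auto simp: N_grp_def upper_triangular_def)
  then have "det u = prod_list (diag_mat u)" using c by (rule det_upper_triangular)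
  also have "\<dots> = 1" using u c by (auto simp: diag_mat_def N_grp_def prod.list_conv_set_nth)
  finally show ?thesis using c by (simp add: GL_def)
qed

lemma finite_card_carrier_vec:
  "finite (carrier_vec n :: 'k::finite vec set)"
  "card (carrier_vec n :: 'k::finite vec set) = CARD('k) ^ n"
proof -
  have b: "bij_betw (vec n) (PiE {..<n} (\<lambda>_. UNIV)) (carrier_vec n :: 'k vec set)"
  proof (rule bij_betw_byWitness[where f' = "\<lambda>v. restrict (\<lambda>i. v $ i) {..<n}"])
    show "\<forall>a\<in>{..<n} \<rightarrow>\<^sub>E UNIV. (\<lambda>i\<in>{..<n}. vec n a $ i) = a"
      by (auto simp: fun_eq_iff PiE_def extensional_def)
    show "\<forall>v\<in>carrier_vec n. vec n (\<lambda>i\<in>{..<n}. v $ i) = v"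
      by (intro ballI eq_vecI) auto
    show "vec n ` ({..<n} \<rightarrow>\<^sub>E UNIV) \<subseteq> carrier_vec n" by (intro image_subsetI) simp
    show "(\<lambda>v. \<lambda>i\<in>{..<n}. v $ i) ` carrier_vec n \<subseteq> {..<n} \<rightarrow>\<^sub>E UNIV" 
      by (intro image_subsetI restrict_PiE_iff[THEN iffD2]) simp
  qed
  show "card (carrier_vec n :: 'k vec set) = CARD('k) ^ n"
    using bij_betw_same_card[OF b] by (simp add: card_PiE)
  show "finite (carrier_vec n :: 'k vec set)"
    using bij_betw_finite[OF b] by (simp add: finite_PiE)
qed

lemma finite_carrier_mat: "finite (carrier_mat a b :: 'k::finite mat set)"
proof -
  have "(carrier_mat a b :: 'k mat set) \<subseteq> mat a b ` (PiE ({..<a} \<times> {..<b}) (\<lambda>_. UNIV))"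
  proof
    fix M :: "'k mat" assume M: "M \<in> carrier_mat a b"
    have "M = mat a b (restrict (\<lambda>ij. M $$ ij) ({..<a} \<times> {..<b}))"
      using M by (intro eq_matI) auto
    moreover have "restrict (\<lambda>ij. M $$ ij) ({..<a} \<times> {..<b}) \<in> PiE ({..<a} \<times> {..<b}) (\<lambda>_. UNIV)"
      by (intro restrict_PiE_iff[THEN iffD2]) simp
    ultimately show "M \<in> mat a b ` (PiE ({..<a} \<times> {..<b}) (\<lambda>_. UNIV))"
      by (rule image_eqI[where f = "mat a b"])
  qed
  then show ?thesis by (rule finite_subset) (intro finite_imageI finite_PiE; simp)
qed

lemma finite_GL: "finite (GL n :: 'k::{field,finite} mat set)"
  by (rule finite_subset[OF _ finite_carrier_mat[of n n]]) (auto simp: GL_def)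

lemma finite_N: "finite (N_grp n :: 'k::{field,finite} mat set)"
  by (rule finite_subset[OF _ finite_carrier_mat[of n n]]) (auto simp: N_grp_def)

text \<open>The entries strictly above the diagonal are free coordinates. Only the shape of the
  order matters: a power of q is a unit of A, which makes averaging over N_n possible.\<close>

lemma card_N_power: "\<exists>e. card (N_grp n :: 'k::{field,finite} mat set) = CARD('k) ^ e"
proof -
  define S where "S = {(i,j). i < j \<and> j < n}"
  have fS: "finite S" by (rule finite_subset[of _ "{..<n} \<times> {..<n}"]) (auto simp: S_def)
  define f where "f = (\<lambda>y. mat n n (\<lambda>(i,j). if i < j then y (i,j) else if i = j then 1 else (0::'k)))"
  have "bij_betw f (PiE S (\<lambda>_. UNIV)) (N_grp n)"
  proof (rule bij_betw_byWitness[where f' = "\<lambda>u. restrict (\<lambda>ij. u $$ ij) S"])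
    show "\<forall>a\<in>S \<rightarrow>\<^sub>E UNIV. (\<lambda>ij\<in>S. f a $$ ij) = a"
    proof (intro ballI ext)
      fix a :: "nat \<times> nat \<Rightarrow> 'k" and x assume a: "a \<in> S \<rightarrow>\<^sub>E UNIV"
      show "(\<lambda>ij\<in>S. f a $$ ij) x = a x"
      proof (cases "x \<in> S")
        case True
        then show ?thesis by (cases x) (simp add: f_def S_def)
      next
        case False
        then show ?thesis using PiE_arb[OF a] by simp
      qed
    qed
    show "\<forall>u\<in>N_grp n. f (\<lambda>ij\<in>S. u $$ ij) = u"
    proof (intro ballI eq_matI)
      fix u :: "'k mat" and i j assume u: "u \<in> N_grp n" and ij: "i < dim_row u" "j < dim_col u"
      then have "i < n" "j < n" by (auto simp: N_grp_def)
      then show "f (\<lambda>ij\<in>S. u $$ ij) $$ (i,j) = u $$ (i,j)"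
        using u by (cases i j rule: linorder_cases) (simp_all add: f_def S_def N_grp_def)
    qed (auto simp: f_def N_grp_def)
    show "f ` (S \<rightarrow>\<^sub>E UNIV) \<subseteq> N_grp n"
      by (intro image_subsetI) (simp add: N_grp_def f_def)
    show "(\<lambda>u. \<lambda>ij\<in>S. u $$ ij) ` N_grp n \<subseteq> S \<rightarrow>\<^sub>E UNIV"
      by (intro image_subsetI restrict_PiE_iff[THEN iffD2]) simp
  qed
  from bij_betw_same_card[OF this] have "card (N_grp n :: 'k mat set) = CARD('k) ^ card S"
    using fS by (simp add: card_PiE)
  then show ?thesis by blast
qed

text \<open>Cauchy's theorem, taken from Sylow with exponent 1: the additive group has a subgroup of
  order r, and a nonzero x in it satisfies r x = 0, so r = 0 in the field. If r and p were distinct,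
  a Bezout relation would give 1 = 0.\<close>

lemma prime_dvd_card_field:
  assumes "prime p" "of_nat p = (0::'k::{field,finite})" "prime r" "r dvd CARD('k)"
  shows "r = p"
proof (rule ccontr)
  assume ne: "r \<noteq> p"
  let ?G = "\<lparr>carrier = (UNIV::'k set), monoid.mult = (+), one = 0\<rparr>"
  interpret G: group ?G
    by (rule groupI) (auto simp: add.assoc intro: exI[of _ "- _"] add.left_inverse)
  have pw: "x [^]\<^bsub>?G\<^esub> (k::nat) = of_nat k * x" for x :: 'k and k
    by (induction k) (auto simp: algebra_simps)
  obtain c where c: "CARD('k) = r ^ 1 * c" using assms(4) by auto
  obtain H where H: "subgroup H ?G" "card H = r ^ 1"
    using sylow_thm[OF assms(3) G.is_group, of 1 c] c by (auto simp: order_def)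
  have fin: "finite H" by (rule finite)
  have "card H > 1" using H(2) assms(3) prime_gt_1_nat by simp
  then obtain x where x: "x \<in> H" "x \<noteq> 0"
    by (metis card_le_Suc0_iff_eq fin not_less One_nat_def)
  interpret H: group "?G\<lparr>carrier := H\<rparr>" using H(1) G.is_group subgroup.subgroup_is_group by blast
  have "x [^]\<^bsub>?G\<lparr>carrier := H\<rparr>\<^esub> order (?G\<lparr>carrier := H\<rparr>) = \<one>\<^bsub>?G\<lparr>carrier := H\<rparr>\<^esub>"
    using H.pow_order_eq_1[of x] x by simp
  then have "of_nat r * x = 0"
    using H(2) pw[of x r] by (simp add: order_def nat_pow_def)
  then have r0: "of_nat r = (0::'k)" using x by simp
  have "coprime r p" using assms(1,3) ne primes_coprime by blast
  then have "gcd (int r) (int p) = 1" by simp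
  then obtain a b where "a * int r + b * int p = 1"
    using bezout_int[of "int r" "int p"] by auto
  then have "of_int a * of_nat r + of_int b * of_nat p = (1::'k)"
    by (metis of_int_1 of_int_add of_int_mult of_int_of_nat_eq)
  then show False using r0 assms(2) by simp
qed

text \<open>Since p is the only prime divisor of q, q is a power of p, and powers of a unit are
  units.\<close>

lemma card_field_unit:
  assumes "prime p" "of_nat p = (0::'k::{field,finite})" "of_nat p dvd (1::'a::comm_ring_1)"
  shows "of_nat CARD('k) dvd (1::'a)"
proof -
  have "CARD('k) = p ^ multiplicity p CARD('k)"
  proof -
    have "prime_factors CARD('k) \<subseteq> {p}"
      using prime_dvd_card_field[OF assms(1,2)] by (auto simp: prime_factors_dvd)
    then have "(\<Prod>r\<in>prime_factors CARD('k). r ^ multiplicity r CARD('k))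
        = (\<Prod>r\<in>{p}. r ^ multiplicity r CARD('k))"
      by (rule prod.mono_neutral_left[rotated])
         (use assms(1) in \<open>auto simp: prime_factors_multiplicity\<close>)
    then show ?thesis using prime_factorization_nat[of "CARD('k)"] by simp
  qed
  moreover have "of_nat (p ^ e) dvd (1::'a)" for e
  proof (induction e)
    case (Suc e)
    then show ?case using mult_dvd_mono[OF assms(3) Suc] by simp
  qed simp
  ultimately show ?thesis by metis
qed

section \<open>The subgroups U_{s+1} and N_n of G_n, and the action of G_t on U_{t+1}\<close>

section \<open>Unipotent column subgroups\<close>

text \<open>The image of U_{s+1} in the top left corner of G_n: indices start at 0, so the free
  column is s and has s entries. The last one, at s - 1, lies on the superdiagonal and is the one
  that psi sees.\<close>

definition col_unip :: "nat \<Rightarrow> nat \<Rightarrow> 'k::field vec \<Rightarrow> 'k mat" where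
  "col_unip n s z = mat n n (\<lambda>(i,j). if i = j then 1 else if j = s \<and> i < s then z $ i else 0)"

definition psiN :: "('k::field \<Rightarrow> 'a) \<Rightarrow> nat \<Rightarrow> 'k mat \<Rightarrow> 'a" where
  "psiN chi n u = chi (\<Sum>i<n - 1. u $$ (i, i + 1))"

lemma col_unip_carrier [simp]: "col_unip n s z \<in> carrier_mat n n"
  by (simp add: col_unip_def)

lemma embed_tl_carrier [simp]: "embed_tl n h \<in> carrier_mat n n"
  by (simp add: embed_tl_def)

lemma index_mult_mat_sum:
  assumes "A \<in> carrier_mat a b" "B \<in> carrier_mat b c" "i < a" "j < c"
  shows "(A * B) $$ (i,j) = (\<Sum>k<b. A $$ (i,k) * B $$ (k,j))"
  using assms by (auto simp: scalar_prod_def atLeast0LessThan intro!: sum.cong)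

lemma mult_mat_vec_index_sum:
  assumes "A \<in> carrier_mat a b" "y \<in> carrier_vec b" "i < a"
  shows "(A *\<^sub>v y) $ i = (\<Sum>k<b. A $$ (i,k) * y $ k)"
  using assms by (auto simp: scalar_prod_def atLeast0LessThan intro!: sum.cong)

lemma mult_col_unip_index:
  assumes "A \<in> carrier_mat a n" "i < a" "j < n" "s < n"
  shows "(A * col_unip n s z) $$ (i,j) = A $$ (i,j) + (if j = s then \<Sum>k<s. A $$ (i,k) * z $ k else 0)"
proof -
  have "(A * col_unip n s z) $$ (i,j) = (\<Sum>k<n. A $$ (i,k) * col_unip n s z $$ (k,j))"
    using assms by (intro index_mult_mat_sum) auto
  also have "\<dots> = (\<Sum>k<n. (if k = j then A $$ (i,k) else 0)
      + (if k < s then if j = s then A $$ (i,k) * z $ k else 0 else 0))"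
    using assms by (intro sum.cong) (auto simp: col_unip_def)
  also have "\<dots> = A $$ (i,j) + (\<Sum>k<n. if k < s then if j = s then A $$ (i,k) * z $ k else 0 else 0)"
    using assms by (simp add: sum.distrib)
  also have "(\<Sum>k<n. if k < s then if j = s then A $$ (i,k) * z $ k else 0 else 0)
      = (\<Sum>k<s. if j = s then A $$ (i,k) * z $ k else 0)"
    using assms by (intro sum.mono_neutral_cong_right) auto
  finally show ?thesis by (cases "j = s") simp_all
qed

lemma col_unip_mult_index:
  assumes "A \<in> carrier_mat n b" "i < n" "j < b" "s < n"
  shows "(col_unip n s z * A) $$ (i,j) = A $$ (i,j) + (if i < s then z $ i * A $$ (s,j) else 0)"
proof -
  have "(col_unip n s z * A) $$ (i,j) = (\<Sum>k<n. col_unip n s z $$ (i,k) * A $$ (k,j))"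
    using assms by (intro index_mult_mat_sum) auto
  also have "\<dots> = (\<Sum>k<n. (if k = i then A $$ (k,j) else 0)
      + (if k = s then if i < s then z $ i * A $$ (k,j) else 0 else 0))"
    using assms by (intro sum.cong) (auto simp: col_unip_def)
  finally show ?thesis using assms by (simp add: sum.distrib)
qed

lemma mult_embed_tl_index:
  assumes "A \<in> carrier_mat a n" "i < a" "j < n" "h \<in> carrier_mat m m" "m \<le> n"
  shows "(A * embed_tl n h) $$ (i,j) = (if j < m then \<Sum>k<m. A $$ (i,k) * h $$ (k,j) else A $$ (i,j))"
proof -
  have e: "(A * embed_tl n h) $$ (i,j) = (\<Sum>k<n. A $$ (i,k) * embed_tl n h $$ (k,j))"
    using assms by (intro index_mult_mat_sum) auto
  show ?thesis
  proof (cases "j < m")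
    case True
    have "(\<Sum>k<n. A $$ (i,k) * embed_tl n h $$ (k,j)) = (\<Sum>k<m. A $$ (i,k) * h $$ (k,j))"
      using assms True by (intro sum.mono_neutral_cong_right) (auto simp: embed_tl_def)
    then show ?thesis using e True by simp
  next
    case False
    have "(\<Sum>k<n. A $$ (i,k) * embed_tl n h $$ (k,j)) = (\<Sum>k<n. if k = j then A $$ (i,k) else 0)"
      using assms False by (intro sum.cong) (auto simp: embed_tl_def)
    then show ?thesis using e False assms by simp
  qed
qed

lemma embed_tl_mult:
  assumes "g \<in> carrier_mat m m" "h \<in> carrier_mat m m" "m \<le> n"
  shows "embed_tl n (g * h) = embed_tl n g * embed_tl n h"
proof (rule eq_matI)
  fix i j assume "i < dim_row (embed_tl n g * embed_tl n h)" "j < dim_col (embed_tl n g * embed_tl n h)"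
  then have ij: "i < n" "j < n" using embed_tl_carrier[of n g] embed_tl_carrier[of n h] by auto
  show "embed_tl n (g * h) $$ (i,j) = (embed_tl n g * embed_tl n h) $$ (i,j)"
    unfolding mult_embed_tl_index[OF embed_tl_carrier ij assms(2,3)]
    using ij assms index_mult_mat_sum[OF assms(1,2)]
    by (auto simp: embed_tl_def intro!: sum.neutral sum.cong)
qed (simp_all add: embed_tl_def)

lemma embed_tl_one: "m \<le> n \<Longrightarrow> embed_tl n (1\<^sub>m m) = 1\<^sub>m n"
  by (rule eq_matI) (auto simp: embed_tl_def)

lemma embed_tl_GL:
  assumes "h \<in> GL m" "m \<le> n"
  shows "embed_tl n h \<in> GL n"
proof -
  obtain k where k: "k \<in> GL m" "h * k = 1\<^sub>m m" using GL_inverse[OF assms(1)] by metis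
  have "embed_tl n h * embed_tl n k = 1\<^sub>m n"
    using k assms embed_tl_mult[of h m k n] by (simp add: GL_carrier embed_tl_one)
  then have "det (embed_tl n h) * det (embed_tl n k) = 1"
    by (metis det_mult det_one embed_tl_carrier)
  then show ?thesis by (auto simp: GL_def)
qed

lemma embed_tl_embed_tl:
  assumes "h \<in> carrier_mat m m" "m \<le> k" "k \<le> n"
  shows "embed_tl n (embed_tl k h) = embed_tl n h"
  using assms by (intro eq_matI) (auto simp: embed_tl_def)

lemma embed_tl_col_unip: "t < k \<Longrightarrow> k \<le> n \<Longrightarrow> embed_tl n (col_unip k t y) = col_unip n t y"
  by (rule eq_matI) (auto simp: embed_tl_def col_unip_def)

lemma col_unip_N: "col_unip n s z \<in> N_grp n"
  by (auto simp: N_grp_def col_unip_def)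

lemma col_unip_GL [simp]: "col_unip n s z \<in> GL n"
  by (rule N_GL[OF col_unip_N])

lemma col_unip_add:
  assumes "y \<in> carrier_vec s" "z \<in> carrier_vec s" "s < n"
  shows "col_unip n s y * col_unip n s z = col_unip n s (y + z)"
proof (rule eq_matI)
  fix i j assume "i < dim_row (col_unip n s (y + z))" "j < dim_col (col_unip n s (y + z))"
  then have "i < n" "j < n" by (auto simp: col_unip_def)
  then show "(col_unip n s y * col_unip n s z) $$ (i,j) = col_unip n s (y + z) $$ (i,j)"
    using assms col_unip_mult_index[OF col_unip_carrier, of i n j s y s z]
    by (auto simp: col_unip_def)
qed (simp_all add: col_unip_def)

lemma col_unip_zero: "col_unip n s (0\<^sub>v s) = 1\<^sub>m n"
  by (rule eq_matI) (auto simp: col_unip_def)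

text \<open>G_t normalises U_{t+1} and acts on it as on column vectors. Conjugation of
  \<open>col_unip\<close> in the descent and in \<open>zeta_left\<close> reduces to this
  identity.\<close>

lemma embed_tl_mult_col_unip:
  assumes h: "h \<in> carrier_mat t t" and y: "y \<in> carrier_vec t" and t: "t < n"
  shows "embed_tl n h * col_unip n t y = col_unip n t (h *\<^sub>v y) * embed_tl n h"
proof (rule eq_matI)
  fix i j assume "i < dim_row (col_unip n t (h *\<^sub>v y) * embed_tl n h)"
    "j < dim_col (col_unip n t (h *\<^sub>v y) * embed_tl n h)"
  then have ij: "i < n" "j < n" by (auto simp: col_unip_def embed_tl_def)
  have hy: "(h *\<^sub>v y) $ i = (\<Sum>k<t. h $$ (i,k) * y $ k)" if "i < t"
    using that h y by (intro mult_mat_vec_index_sum)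
  have s0: "(\<Sum>k<t. embed_tl n h $$ (i,k) * y $ k) = (if i < t then (h *\<^sub>v y) $ i else 0)"
    using ij h t hy by (auto simp: embed_tl_def intro!: sum.cong sum.neutral)
  have row: "embed_tl n h $$ (t,j) = (if j = t then 1 else 0)"
    using ij h t by (auto simp: embed_tl_def)
  show "(embed_tl n h * col_unip n t y) $$ (i,j) = (col_unip n t (h *\<^sub>v y) * embed_tl n h) $$ (i,j)"
    unfolding mult_col_unip_index[OF embed_tl_carrier ij t]
      col_unip_mult_index[OF embed_tl_carrier ij t] s0 row
    by auto
qed (simp_all add: col_unip_def embed_tl_def)

text \<open>As t < s, the matrix has the last row of the identity, so it lies in P_s, and
  conjugation by it fixes the character psi of U_{s+1}.\<close>

lemma col_unip_mult_vec_last: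
  assumes "t < s" "z \<in> carrier_vec s" "y \<in> carrier_vec t"
  shows "(col_unip s t y *\<^sub>v z) $ (s - 1) = z $ (s - 1)"
proof -
  have "(col_unip s t y *\<^sub>v z) $ (s - 1) = (\<Sum>k<s. col_unip s t y $$ (s-1,k) * z $ k)"
    using assms by (intro mult_mat_vec_index_sum) auto
  also have "\<dots> = (\<Sum>k<s. if k = s - 1 then z $ k else 0)"
    using assms by (intro sum.cong) (auto simp: col_unip_def)
  finally show ?thesis using assms by simp
qed

text \<open>The same reason, for G_t inside P_s.\<close>

lemma embed_tl_mult_vec_last:
  assumes "t < s" "z \<in> carrier_vec s" "h \<in> carrier_mat t t"
  shows "(embed_tl s h *\<^sub>v z) $ (s - 1) = z $ (s - 1)"
proof -
  have "(embed_tl s h *\<^sub>v z) $ (s - 1) = (\<Sum>k<s. embed_tl s h $$ (s-1,k) * z $ k)"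
    using assms by (intro mult_mat_vec_index_sum) auto
  also have "\<dots> = (\<Sum>k<s. if k = s - 1 then z $ k else 0)"
    using assms by (intro sum.cong) (auto simp: embed_tl_def)
  finally show ?thesis using assms by simp
qed

lemma psiN_col_unip:
  assumes "0 < s" "s < n"
  shows "psiN chi n (col_unip n s z) = chi (z $ (s - 1))"
proof -
  have "(\<Sum>i<n - 1. col_unip n s z $$ (i, i + 1)) = (\<Sum>i<n - 1. if i = s - 1 then z $ i else 0)"
    using assms by (intro sum.cong) (auto simp: col_unip_def)
  then show ?thesis using assms by (auto simp: psiN_def)
qed

text \<open>Translates the generators of \<open>deriv_kernel\<close> into \<open>col_unip\<close>.
  For s = 0 the group is trivial and there is no superdiagonal entry to compare.\<close>

lemma U_grp_col_unip:
  assumes "u \<in> U_grp (Suc s)" "s < n"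
  obtains z where "z \<in> carrier_vec s" "embed_tl n u = col_unip n s z"
    "0 < s \<Longrightarrow> u $$ (s - 1, s) = z $ (s - 1)"
proof
  let ?z = "vec s (\<lambda>i. u $$ (i, s))"
  show "embed_tl n u = col_unip n s ?z"
    using assms by (intro eq_matI) (auto simp: U_grp_def embed_tl_def col_unip_def less_Suc_eq)
qed auto

lemma col_unip_U_grp: "col_unip (Suc s) s z \<in> U_grp (Suc s)"
  by (auto simp: U_grp_def col_unip_def)

lemma N_grp_mult:
  assumes "u \<in> N_grp n" "v \<in> N_grp n"
  shows "u * v \<in> N_grp n" "i + 1 < n \<Longrightarrow> (u * v) $$ (i,i+1) = u $$ (i,i+1) + v $$ (i,i+1)"
proof -
  have c: "u \<in> carrier_mat n n" "v \<in> carrier_mat n n" using assms by (auto simp: N_grp_def)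
  have z: "u $$ (i,j) = 0" "v $$ (i,j) = 0" if "j < i" "i < n" for i j
    using assms that by (auto simp: N_grp_def)
  have d: "u $$ (i,i) = 1" "v $$ (i,i) = 1" if "i < n" for i
    using assms that by (auto simp: N_grp_def)
  have low: "(u * v) $$ (i,j) = 0" if "j < i" "i < n" for i j
  proof -
    have "(\<Sum>k<n. u $$ (i,k) * v $$ (k,j)) = 0"
    proof (rule sum.neutral, rule ballI)
      fix k assume "k \<in> {..<n}"
      then show "u $$ (i,k) * v $$ (k,j) = 0" using that z[of k i] z[of j k] by (cases "k < i") auto
    qed
    then show ?thesis using that index_mult_mat_sum[OF c, of i j] by simp
  qed
  have diag: "(u * v) $$ (i,i) = 1" if "i < n" for i
  proof -
    have "(\<Sum>k<n. u $$ (i,k) * v $$ (k,i)) = (\<Sum>k<n. if k = i then 1 else 0)"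
    proof (rule sum.cong)
      fix k assume "k \<in> {..<n}"
      then show "u $$ (i,k) * v $$ (k,i) = (if k = i then 1 else 0)"
        using that z[of k i] z[of i k] d by (cases k i rule: linorder_cases) auto
    qed simp
    then show ?thesis using that index_mult_mat_sum[OF c, of i i] by simp
  qed
  show "u * v \<in> N_grp n" using c low diag by (auto simp: N_grp_def)
  assume i: "i + 1 < n"
  have "(\<Sum>k<n. u $$ (i,k) * v $$ (k,i+1))
      = (\<Sum>k<n. (if k = i then v $$ (i,i+1) else 0) + (if k = i + 1 then u $$ (i,i+1) else 0))"
  proof (rule sum.cong)
    fix k assume k: "k \<in> {..<n}"
    consider "k < i" | "k = i" | "k = i + 1" | "k > i + 1" by linarith
    then show "u $$ (i,k) * v $$ (k,i+1)
      = (if k = i then v $$ (i,i+1) else 0) + (if k = i + 1 then u $$ (i,i+1) else 0)"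
      using k i z d by cases auto
  qed simp
  then show "(u * v) $$ (i,i+1) = u $$ (i,i+1) + v $$ (i,i+1)"
    using i index_mult_mat_sum[OF c, of i "i+1"] by (simp add: sum.distrib)
qed

lemma N_carrier: "u \<in> N_grp n \<Longrightarrow> u \<in> carrier_mat n n"
  by (simp add: N_grp_def)

lemma N_bij_left:
  assumes "v \<in> N_grp n"
  shows "bij_betw (\<lambda>u. v * u) (N_grp n) (N_grp n :: 'k::{field,finite} mat set)"
proof -
  obtain w where w: "w \<in> GL n" "w * v = 1\<^sub>m n" using GL_inverse[OF N_GL[OF assms]] by metis
  have "inj_on (\<lambda>u. v * u) (N_grp n)"
  proof (rule inj_on_inverseI[where g = "\<lambda>u. w * u"])
    fix u :: "'k mat" assume "u \<in> N_grp n"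
    then show "w * (v * u) = u"
      using w assms assoc_mult_mat[of w n n v n u n] 
      by (simp add: N_carrier GL_carrier left_mult_one_mat[of _ n n])
  qed
  moreover have "(\<lambda>u. v * u) ` N_grp n \<subseteq> N_grp n" using assms N_grp_mult(1) by blast
  ultimately show ?thesis
    using endo_inj_surj[OF finite_N[of n]] by (simp add: bij_betw_def)
qed

lemma GL_bij_right:
  assumes "h \<in> GL n"
  shows "bij_betw (\<lambda>x. x * h) (GL n) (GL n :: 'k::{field,finite} mat set)"
proof -
  obtain w where w: "w \<in> GL n" "h * w = 1\<^sub>m n" using GL_inverse[OF assms] by metis
  have "inj_on (\<lambda>u. u * h) (GL n)"
  proof (rule inj_on_inverseI[where g = "\<lambda>u. u * w"])
    fix u :: "'k mat" assume "u \<in> GL n"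
    then show "u * h * w = u"
      using w assms by (simp add: assoc_mult_mat[of _ n n _ n _ n] GL_carrier right_mult_one_mat[of _ n n])
  qed
  moreover have "(\<lambda>u. u * h) ` GL n \<subseteq> GL n" using assms GL_mult by blast
  ultimately show ?thesis
    using endo_inj_surj[OF finite_GL[of n]] by (simp add: bij_betw_def)
qed

lemma GL_bij_vec:
  assumes "h \<in> GL t"
  shows "bij_betw (\<lambda>y. h *\<^sub>v y) (carrier_vec t) (carrier_vec t :: 'k::{field,finite} vec set)"
proof -
  obtain w where w: "w \<in> GL t" "w * h = 1\<^sub>m t" using GL_inverse[OF assms] by metis
  have "inj_on (\<lambda>y. h *\<^sub>v y) (carrier_vec t)"
  proof (rule inj_on_inverseI[where g = "\<lambda>y. w *\<^sub>v y"])
    fix y :: "'k vec" assume "y \<in> carrier_vec t"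
    then show "w *\<^sub>v (h *\<^sub>v y) = y"
      using w assms by (simp flip: assoc_mult_mat_vec[of _ t t _ t] add: GL_carrier)
  qed
  moreover have "(\<lambda>y. h *\<^sub>v y) ` carrier_vec t \<subseteq> carrier_vec t"
    using GL_carrier[OF assms] by auto
  ultimately show ?thesis
    using endo_inj_surj[OF finite_card_carrier_vec(1)[of t]] by (simp add: bij_betw_def)
qed

text \<open>Transitivity of G_t on the nontrivial characters of U_{t+1}: these correspond to nonzero
  row vectors v, and each such v is the last row of an invertible matrix.\<close>

lemma GL_with_last_row:
  assumes v: "v \<in> carrier_vec t" "v \<noteq> 0\<^sub>v t"
  obtains h where "h \<in> GL t" "\<And>y. y \<in> carrier_vec t \<Longrightarrow> (h *\<^sub>v y) $ (t - 1) = v \<bullet> (y :: 'k::field vec)"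
proof -
  obtain i where i: "i < t" "v $ i \<noteq> 0"
    using v by (metis carrier_vecD eq_vecI index_zero_vec(1) index_zero_vec(2))
  \<comment> \<open>P exchanges the coordinates i and t - 1, where v_i is nonzero. L is lower
    triangular, and its last row is v with these coordinates exchanged: the corner entry is v_i, so
    L is invertible, and L * P has last row v.\<close>
  define P where "P = mat t t (\<lambda>(a,b). if b = (if a = i then t - 1 else if a = t - 1 then i else a) then 1 else (0::'k))"
  define L where "L = mat t t (\<lambda>(a,b). if a = t - 1 then (if b = t - 1 then v $ i else if b = i then v $ (t - 1) else v $ b)
     else if a = b then 1 else (0::'k))"
  have Pc: "P \<in> carrier_mat t t" and Lc: "L \<in> carrier_mat t t" by (auto simp: P_def L_def)
  let ?s = "\<lambda>a. if a = i then t - 1 else if a = t - 1 then i else a"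
  have PP: "P * P = 1\<^sub>m t"
  proof (rule eq_matI)
    fix a b assume "a < dim_row (1\<^sub>m t :: 'k mat)" "b < dim_col (1\<^sub>m t :: 'k mat)"
    then have ab: "a < t" "b < t" by auto
    have "(P * P) $$ (a,b) = (\<Sum>k<t. P $$ (a,k) * P $$ (k,b))" using index_mult_mat_sum[OF Pc Pc ab] .
    also have "\<dots> = (\<Sum>k<t. if k = ?s a then P $$ (k,b) else 0)"
      using ab by (intro sum.cong) (auto simp: P_def)
    also have "\<dots> = P $$ (?s a, b)" using ab i by simp
    also have "\<dots> = 1\<^sub>m t $$ (a,b)" using ab i by (auto simp: P_def)
    finally show "(P * P) $$ (a,b) = 1\<^sub>m t $$ (a,b)" .
  qed (auto simp: P_def)
  have "det P * det P = 1" using PP det_mult[OF Pc Pc] by simp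
  then have PG: "P \<in> GL t" using Pc by (auto simp: GL_def)
  have "det L = prod_list (diag_mat L)"
    by (rule det_lower_triangular[OF _ Lc]) (auto simp: L_def)
  then have "det L \<noteq> 0" using i by (auto simp: diag_mat_def L_def)
  then have LG: "L \<in> GL t" using Lc by (simp add: GL_def)
  show thesis
  proof (rule that[OF GL_mult[OF LG PG]])
    fix y :: "'k vec" assume y: "y \<in> carrier_vec t"
    have r: "(L * P) $$ (t - 1, b) = v $ b" if "b < t" for b
    proof -
      have "(L * P) $$ (t - 1, b) = (\<Sum>k<t. L $$ (t - 1,k) * P $$ (k,b))"
        using index_mult_mat_sum[OF Lc Pc _ that, of "t - 1"] i by simp
      also have "\<dots> = (\<Sum>k<t. if k = ?s b then L $$ (t - 1,k) else 0)"
        using that i by (intro sum.cong) (auto simp: P_def)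
      also have "\<dots> = L $$ (t - 1, ?s b)" using that i by simp
      also have "\<dots> = v $ b" using that i by (auto simp: L_def)
      finally show ?thesis .
    qed
    have "(L * P *\<^sub>v y) $ (t - 1) = (\<Sum>b<t. (L * P) $$ (t - 1, b) * y $ b)"
      using i y mult_carrier_mat[OF Lc Pc] by (intro mult_mat_vec_index_sum) auto
    also have "\<dots> = v \<bullet> y" using r y by (simp add: scalar_prod_def atLeast0LessThan)
    finally show "(L * P *\<^sub>v y) $ (t - 1) = v \<bullet> y" .
  qed
qed

section \<open>Fourier analysis on column vectors, with values in A\<close>

section \<open>Additive characters\<close>

lemma unit_cancel_left:
  fixes a :: "'a::comm_ring_1"
  assumes "a dvd 1" "a * b = a * c"
  shows "b = c"
proof -
  obtain d where d: "1 = a * d" using assms(1) by (elim dvdE)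
  have "x = d * (a * x)" for x using d by (metis mult.assoc mult.commute mult_1)
  then show ?thesis using assms(2) by metis
qed

text \<open>Nontriviality takes the form of a vanishing sum: over a ring with zero divisors, some
  value of chi other than 1 would not give orthogonality.\<close>

locale additive_character =
  fixes chi :: "'k::{field,finite} \<Rightarrow> 'a::comm_ring_1"
  assumes chi_add: "chi (x + y) = chi x * chi y"
    and chi_0 [simp]: "chi 0 = 1"
    and chi_sum: "(\<Sum>x\<in>UNIV. chi x) = 0"
    and card_unit: "of_nat CARD('k) dvd (1::'a)"
begin

lemma chi_minus: "chi (- x) * chi x = 1" "chi x * chi (- x) = 1"
  using chi_add[of "- x" x] chi_add[of x "- x"] by simp_all

lemma psi_inv_character: "additive_character (psi_inv chi)"
proof
  show "(\<Sum>x\<in>UNIV. psi_inv chi x) = 0"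
    using chi_sum sum.reindex_bij_betw[of uminus UNIV UNIV chi]
    by (simp add: psi_inv_def bij_uminus)
  show "psi_inv chi (x + y) = psi_inv chi x * psi_inv chi y" for x y
    using chi_add[of "- x" "- y"] by (simp add: psi_inv_def)
qed (simp_all add: psi_inv_def card_unit)

lemma chi_sum_scaled:
  assumes "c \<noteq> 0"
  shows "(\<Sum>a\<in>UNIV. chi (c * a)) = 0"
proof -
  have "bij ((*) c)" using assms
    by (intro bij_betw_byWitness[where f' = "\<lambda>x. x / c"]) auto
  then show ?thesis using chi_sum sum.reindex_bij_betw[of "(*) c" UNIV UNIV chi] by simp
qed

text \<open>Summing the hypothesis over all a gives q x = 0, and q is a unit.\<close>

lemma eq_zero_by_char:
  assumes "c \<noteq> 0" "\<And>a. x = chi (c * a) * x"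
  shows "x = 0"
proof -
  have "of_nat CARD('k) * x = (\<Sum>a\<in>(UNIV::'k set). x)" by simp
  also have "\<dots> = (\<Sum>a\<in>UNIV. chi (c * a) * x)" using assms(2) by (intro sum.cong) auto
  also have "\<dots> = 0" using chi_sum_scaled[OF assms(1)] by (simp flip: sum_distrib_right)
  finally show ?thesis using unit_cancel_left[OF card_unit, of x 0] by simp
qed

lemma card_power_unit: "of_nat (CARD('k) ^ e) dvd (1::'a)"
proof (induction e)
  case (Suc e)
  then show ?case using mult_dvd_mono[OF card_unit Suc] by simp
qed simp

lemma card_N_unit: "of_nat (card (N_grp n :: 'k mat set)) dvd (1::'a)"
  using card_N_power[where ?'k = 'k, of n] card_power_unit by metis

text \<open>If y_i is nonzero, translating v by a times the i-th unit vector multiplies the sum by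
  chi(y_i a), for every a, and \<open>eq_zero_by_char\<close> applies.\<close>

lemma character_orthogonality:
  assumes y: "y \<in> carrier_vec t"
  shows "(\<Sum>v\<in>carrier_vec t. chi (v \<bullet> y)) = (if y = 0\<^sub>v t then of_nat (CARD('k) ^ t) else 0)"
proof (cases "y = 0\<^sub>v t")
  case True
  then show ?thesis using finite_card_carrier_vec(2)[where ?'k = 'k, of t] by simp
next
  case False
  then obtain i where i: "i < t" "y $ i \<noteq> 0"
    using y by (metis carrier_vecD eq_vecI index_zero_vec(1) index_zero_vec(2))
  let ?S = "\<Sum>v\<in>carrier_vec t. chi (v \<bullet> y)"
  have "?S = chi (y $ i * a) * ?S" for a
  proof -
    let ?e = "a \<cdot>\<^sub>v unit_vec t i"
    have b: "bij_betw (\<lambda>v. v + ?e) (carrier_vec t) (carrier_vec t :: 'k vec set)"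
    proof (rule bij_betw_byWitness[where f' = "\<lambda>v. v - ?e"])
      show "\<forall>v\<in>carrier_vec t. v + ?e - ?e = v" by (intro ballI eq_vecI) auto
      show "\<forall>v\<in>carrier_vec t. v - ?e + ?e = v" by (intro ballI eq_vecI) auto
    qed auto
    have "?S = (\<Sum>v\<in>carrier_vec t. chi ((v + ?e) \<bullet> y))"
      using sum.reindex_bij_betw[OF b, of "\<lambda>v. chi (v \<bullet> y)"] by simp
    also have "\<dots> = (\<Sum>v\<in>carrier_vec t. chi (y $ i * a) * chi (v \<bullet> y))"
    proof (rule sum.cong)
      fix v :: "'k vec" assume v: "v \<in> carrier_vec t"
      have "(v + ?e) \<bullet> y = v \<bullet> y + ?e \<bullet> y"
        by (rule add_scalar_prod_distrib[OF v _ y]) simp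
      also have "?e \<bullet> y = y $ i * a" using y i by simp
      finally have "(v + ?e) \<bullet> y = y $ i * a + v \<bullet> y" by simp
      then show "chi ((v + ?e) \<bullet> y) = chi (y $ i * a) * chi (v \<bullet> y)" by (simp only: chi_add)
    qed simp
    also have "\<dots> = chi (y $ i * a) * ?S" by (simp only: sum_distrib_left)
    finally show ?thesis .
  qed
  from eq_zero_by_char[OF i(2) this] show ?thesis using False by simp
qed

text \<open>Fourier inversion: only the coefficient at 0 survives, so q^t times any value of the
  function is the same sum, and q^t can be cancelled.\<close>

lemma constant_if_fourier_vanish:
  fixes \<phi> :: "'k vec \<Rightarrow> 'a"
  assumes van: "\<And>v. v \<in> carrier_vec t \<Longrightarrow> v \<noteq> 0\<^sub>v t \<Longrightarrow> (\<Sum>y\<in>carrier_vec t. chi (- (v \<bullet> y)) * \<phi> y) = 0"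
    and y: "y0 \<in> carrier_vec t"
  shows "\<phi> y0 = \<phi> (0\<^sub>v t)"
proof -
  let ?V = "carrier_vec t :: 'k vec set" and ?q = "of_nat (CARD('k) ^ t) :: 'a"
  define S where "S v = (\<Sum>y\<in>?V. chi (- (v \<bullet> y)) * \<phi> y)" for v
  have inv: "?q * \<phi> y0 = S (0\<^sub>v t)" if y: "y0 \<in> ?V" for y0
  proof -
    have "S (0\<^sub>v t) = (\<Sum>v\<in>{0\<^sub>v t}. chi (v \<bullet> y0) * S v)" using y by simp
    also have "\<dots> = (\<Sum>v\<in>?V. chi (v \<bullet> y0) * S v)"
      using van finite_card_carrier_vec(1)[where ?'k = 'k, of t]
      by (intro sum.mono_neutral_left) (auto simp: S_def)
    also have "\<dots> = (\<Sum>v\<in>?V. \<Sum>y\<in>?V. chi (v \<bullet> (y0 - y)) * \<phi> y)"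
    proof (rule sum.cong)
      fix v assume v: "v \<in> ?V"
      have "chi (v \<bullet> (y0 - y)) = chi (v \<bullet> y0) * chi (- (v \<bullet> y))" if "y \<in> ?V" for y
        using scalar_prod_minus_distrib[OF v \<open>y0 \<in> ?V\<close> that] chi_add[of "v \<bullet> y0" "- (v \<bullet> y)"] by simp
      then show "chi (v \<bullet> y0) * S v = (\<Sum>y\<in>?V. chi (v \<bullet> (y0 - y)) * \<phi> y)"
        by (simp add: S_def sum_distrib_left mult.assoc)
    qed simp
    also have "\<dots> = (\<Sum>y\<in>?V. (\<Sum>v\<in>?V. chi (v \<bullet> (y0 - y))) * \<phi> y)"
      by (subst sum.swap) (simp add: sum_distrib_right)
    also have "\<dots> = (\<Sum>y\<in>?V. if y = y0 then ?q * \<phi> y else 0)"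
    proof (rule sum.cong)
      fix y assume v: "y \<in> ?V"
      have "y0 - y = 0\<^sub>v t \<longleftrightarrow> y = y0"
      proof
        assume e: "y0 - y = 0\<^sub>v t"
        show "y = y0"
        proof (rule eq_vecI)
          fix i assume "i < dim_vec y0"
          then show "y $ i = y0 $ i" using arg_cong[OF e, of "\<lambda>w. w $ i"] v y by simp
        qed (use v y in simp)
      qed (use y in auto)
      then show "(\<Sum>v\<in>?V. chi (v \<bullet> (y0 - y))) * \<phi> y = (if y = y0 then ?q * \<phi> y else 0)"
        using character_orthogonality[of "y0 - y" t] v y by simp
    qed simp
    also have "\<dots> = ?q * \<phi> y0" using y finite_card_carrier_vec(1)[where ?'k = 'k, of t] by simp
    finally show ?thesis by simp
  qed
  show ?thesis
    by (rule unit_cancel_left[OF card_power_unit[of t], of "\<phi> y0"]) (simp only: inv[OF y] inv[OF zero_carrier_vec])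
qed

lemma psiN_mult:
  assumes "u \<in> N_grp n" "v \<in> N_grp n"
  shows "psiN chi n (u * v) = psiN chi n u * psiN chi n v"
proof -
  have "(\<Sum>i<n - 1. (u * v) $$ (i, i + 1)) = (\<Sum>i<n - 1. u $$ (i, i + 1) + v $$ (i, i + 1))"
    using N_grp_mult(2)[OF assms] by (intro sum.cong) auto
  then show ?thesis by (simp add: psiN_def chi_add sum.distrib)
qed

lemma psiN_psi_inv: "psiN (psi_inv chi) n u * psiN chi n u = 1" 
  by (simp add: psiN_def psi_inv_def chi_minus)

end

text \<open>The values of \<open>kk\<close> are additive only mod p, which suffices because zeta^p =
  1. The sum S over the field satisfies w S = S for w = psi_A(x0), by translation. Adding the
  relations w^j S = S over j < p gives p S = 0, since the powers w^j have the same sum as the powers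
  of zeta.\<close>

lemma psiA_additive_character:
  fixes \<zeta> :: "'a::comm_ring_1" and kk :: "'k::{field,finite} \<Rightarrow> nat"
  assumes p: "prime p" and char: "of_nat p = (0::'k)" and z: "Zp_zeta_algebra p \<zeta>"
    and kk: "additive_mod p kk"
  shows "additive_character (psiA \<zeta> kk)"
proof
  have sum0: "(\<Sum>i<p. \<zeta> ^ i) = 0" and pu: "of_nat p dvd (1::'a)"
    using z by (auto simp: Zp_zeta_algebra_def dvd_def)
  have "\<zeta> ^ p - 1 = (\<zeta> - 1) * (\<Sum>i<p. \<zeta> ^ i)" by (rule power_diff_1_eq)
  then have zp: "\<zeta> ^ p = 1" using sum0 by simp
  have zmod: "\<zeta> ^ (a mod p) = \<zeta> ^ a" for a
  proof -
    have "\<zeta> ^ a = \<zeta> ^ (p * (a div p) + a mod p)" by simp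
    also have "\<dots> = \<zeta> ^ (a mod p)" by (simp only: power_add power_mult zp) simp
    finally show ?thesis by simp
  qed
  show add: "psiA \<zeta> kk (x + y) = psiA \<zeta> kk x * psiA \<zeta> kk y" for x y
  proof -
    have "kk (x + y) mod p = (kk x + kk y) mod p" using kk by (auto simp: additive_mod_def)
    then show ?thesis unfolding psiA_def
      using zmod[of "kk (x + y)"] zmod[of "kk x + kk y"] by (simp add: power_add)
  qed
  have "kk (0 + 0) mod p = (kk 0 + kk 0) mod p" using kk unfolding additive_mod_def by blast
  then have "[0 + kk 0 = kk 0 + kk 0] (mod p)" by (simp add: cong_def)
  then have "kk 0 mod p = 0" by (simp only: cong_add_rcancel_nat) (simp add: cong_def)
  then show "psiA \<zeta> kk 0 = 1" using zmod[of "kk 0"] by (simp add: psiA_def)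
  show "of_nat CARD('k) dvd (1::'a)" by (rule card_field_unit[OF p char pu])
  obtain x0 where x0: "kk x0 mod p \<noteq> 0" using kk by (auto simp: additive_mod_def)
  define S where "S = (\<Sum>x\<in>UNIV. psiA \<zeta> kk x)"
  define w where "w = \<zeta> ^ kk x0"
  have "bij (\<lambda>x. x + x0)" by (intro bij_betw_byWitness[where f' = "\<lambda>x. x - x0"]) auto
  then have "S = (\<Sum>x\<in>UNIV. psiA \<zeta> kk (x + x0))"
    unfolding S_def using sum.reindex_bij_betw[of "\<lambda>x. x + x0" UNIV UNIV "psiA \<zeta> kk"] by simp
  also have "\<dots> = w * S"
    unfolding S_def add sum_distrib_left by (simp only: w_def psiA_def mult.commute)
  finally have wS: "w * S = S" by (rule sym)
  have wj: "w ^ j * S = S" for j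
  proof (induction j)
    case (Suc j)
    have "w ^ Suc j * S = w ^ j * (w * S)" by (simp add: mult_ac)
    then show ?case using Suc wS by simp
  qed simp
  have "(\<Sum>j<p. w ^ j) = 0"
  proof -
    \<comment> \<open>Multiplication by \<open>kk x0\<close>, prime to p, permutes the residues mod
      p, so the powers of w are those of zeta in another order.\<close>
    have cop: "coprime (kk x0) p"
      using p x0 by (metis coprime_commute prime_imp_coprime dvd_imp_mod_0)
    have inj: "inj_on (\<lambda>j. kk x0 * j mod p) {..<p}"
    proof (rule inj_onI)
      fix i j assume ij: "i \<in> {..<p}" "j \<in> {..<p}" "kk x0 * i mod p = kk x0 * j mod p"
      then have "[kk x0 * i = kk x0 * j] (mod p)" by (simp add: cong_def)
      then have "[i = j] (mod p)" using cong_mult_lcancel_nat[OF cop] by simp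
      then show "i = j" using ij by (simp add: cong_def)
    qed
    have "(\<lambda>j. kk x0 * j mod p) ` {..<p} \<subseteq> {..<p}" using p prime_gt_0_nat by auto
    then have b: "bij_betw (\<lambda>j. kk x0 * j mod p) {..<p} {..<p}"
      using inj by (simp add: bij_betw_def endo_inj_surj)
    have "(\<Sum>j<p. w ^ j) = (\<Sum>j<p. \<zeta> ^ (kk x0 * j mod p))"
      by (simp add: zmod w_def power_mult)
    also have "\<dots> = (\<Sum>j<p. \<zeta> ^ j)" by (rule sum.reindex_bij_betw[OF b])
    finally show ?thesis using sum0 by simp
  qed
  then have "0 = (\<Sum>j<p. w ^ j * S)" by (simp flip: sum_distrib_right)
  also have "\<dots> = of_nat p * S" by (simp add: wj)
  finally show "(\<Sum>x\<in>UNIV. psiA \<zeta> kk x) = 0"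
    using unit_cancel_left[OF pu, of S 0] by (simp add: S_def)
qed

section \<open>Whittaker models as function spaces: equivariance and the top derivative\<close>

section \<open>Whittaker models\<close>

text \<open>Collects what is used of a Whittaker model. \<open>W_top\<close> expresses the rank of
  the top derivative through functionals: one that is psi-equivariant under every U_{s+1} vanishes
  wherever evaluation at 1 does. \<open>W_off\<close> reflects the extension of functions by zero
  off G_n.\<close>

locale whittaker_space = additive_character chi
  for chi :: "'k::{field,finite} \<Rightarrow> 'a::comm_ring_1" +
  fixes n :: nat and W :: "('k mat \<Rightarrow> 'a) set"
  assumes W_add: "f \<in> W \<Longrightarrow> g \<in> W \<Longrightarrow> f + g \<in> W"
    and W_scale: "f \<in> W \<Longrightarrow> fscale a f \<in> W"
    and W_transl: "f \<in> W \<Longrightarrow> h \<in> GL n \<Longrightarrow> transl n h f \<in> W"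
    and W_off: "f \<in> W \<Longrightarrow> h \<notin> GL n \<Longrightarrow> f h = 0"
    and W_equiv: "f \<in> W \<Longrightarrow> u \<in> N_grp n \<Longrightarrow> h \<in> GL n \<Longrightarrow> f (u * h) = psiN chi n u * f h"
    and W_value: "\<exists>f\<in>W. f (1\<^sub>m n) = a"
    and W_top: "(\<And>f g. f \<in> W \<Longrightarrow> g \<in> W \<Longrightarrow> \<phi> (f + g) = \<phi> f + \<phi> g)
      \<Longrightarrow> (\<And>a f. f \<in> W \<Longrightarrow> \<phi> (fscale a f) = a * \<phi> f)
      \<Longrightarrow> (\<And>s z f. 0 < s \<Longrightarrow> s < n \<Longrightarrow> z \<in> carrier_vec s \<Longrightarrow> f \<in> W
             \<Longrightarrow> \<phi> (transl n (col_unip n s z) f) = chi (z $ (s - 1)) * \<phi> f)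
      \<Longrightarrow> f \<in> W \<Longrightarrow> f (1\<^sub>m n) = 0 \<Longrightarrow> \<phi> f = (0::'a)"

text \<open>Splits off the last column, N_{r+1} = U_{r+1} N_r, for inductions on r.\<close>

lemma N_grp_Suc_embed:
  assumes u: "u \<in> N_grp (Suc r)" and r: "Suc r \<le> n"
  defines "z \<equiv> vec r (\<lambda>i. u $$ (i, r))" and "v \<equiv> mat r r (\<lambda>ij. u $$ ij)"
  shows "embed_tl n u = col_unip n r z * embed_tl n v" "v \<in> N_grp r"
proof -
  have v: "v \<in> carrier_mat r r" by (simp add: v_def)
  show "v \<in> N_grp r" using u by (auto simp: N_grp_def v_def)
  have uc: "u \<in> carrier_mat (Suc r) (Suc r)" using u by (simp add: N_grp_def)
  show "embed_tl n u = col_unip n r z * embed_tl n v"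
  proof (rule eq_matI)
    fix i j assume "i < dim_row (col_unip n r z * embed_tl n v)" "j < dim_col (col_unip n r z * embed_tl n v)"
    then have ij: "i < n" "j < n" by (auto simp: col_unip_def embed_tl_def)
    have rn: "r < n" using r by simp
    have "embed_tl n v $$ (r,j) = (if j = r then 1 else 0)" using ij v rn by (auto simp: embed_tl_def)
    then show "embed_tl n u $$ (i,j) = (col_unip n r z * embed_tl n v) $$ (i,j)"
      unfolding col_unip_mult_index[OF embed_tl_carrier ij rn]
      using u uc ij rn by (auto simp: embed_tl_def v_def z_def N_grp_def less_Suc_eq)
  qed (auto simp: embed_tl_def col_unip_def)
qed

context
  fixes chi :: "'k::{field,finite} \<Rightarrow> 'a::comm_ring_1" and n :: nat
    and sc :: "'a \<Rightarrow> 'v::ab_group_add \<Rightarrow> 'v" and act :: "'k mat \<Rightarrow> 'v \<Rightarrow> 'v" and l :: "'v \<Rightarrow> 'a"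
  assumes chi: "additive_character chi" and G: "GL_module n sc act"
    and wl: "whittaker_functional n sc act chi l"
begin

interpretation additive_character chi by (rule chi)

interpretation V: Modules.module sc using G by (simp add: GL_module_def)

lemma functional_diff: "l (x - y) = l x - l y"
proof -
  have "l (x - y) + l y = l (x - y + y)" using wl unfolding whittaker_functional_def by metis
  then show ?thesis by (simp add: algebra_simps)
qed

text \<open>Holds because l kills the generators of the kernel of V -> V^(n).\<close>

lemma functional_col_unip:
  assumes "0 < s" "s < n" "z \<in> carrier_vec s"
  shows "l (act (col_unip n s z) v) = chi (z $ (s - 1)) * l v"
proof -
  let ?u = "col_unip (Suc s) s z"
  have e: "embed_tl n ?u = col_unip n s z" using assms by (intro embed_tl_col_unip) auto
  have p: "psiU chi (Suc s) ?u = chi (z $ (s - 1))"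
    using assms by (auto simp: psiU_def col_unip_def)
  have "act (embed_tl n ?u) v - sc (psiU chi (Suc s) ?u) v \<in> deriv_kernel sc act chi n n UNIV"
  proof -
    \<comment> \<open>The index j counts derivatives from the top: j = n - s - 1 gives n - j = s +
      1, and j + 1 < n amounts to 0 < s.\<close>
    have "\<exists>j u w. act (embed_tl n ?u) v - sc (psiU chi (Suc s) ?u) v
        = act (embed_tl n u) w - sc (psiU chi (n - j) u) w \<and> j + 1 < n \<and> u \<in> U_grp (n - j) \<and> w \<in> UNIV"
      using assms col_unip_U_grp[of s z]
      by (intro exI[of _ "n - Suc s"] exI[of _ ?u] exI[of _ v]) auto
    then show ?thesis using assms unfolding deriv_kernel_def by (auto intro!: V.span_base)
  qed
  then have "l (act (col_unip n s z) v - sc (chi (z $ (s - 1))) v) = 0"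
    using wl e p unfolding whittaker_functional_def by auto
  moreover have "l (sc (chi (z $ (s - 1))) v) = chi (z $ (s - 1)) * l v"
    using wl unfolding whittaker_functional_def by blast
  ultimately show ?thesis by (simp add: functional_diff)
qed

lemma act_mult: "g \<in> GL n \<Longrightarrow> h \<in> GL n \<Longrightarrow> act (g * h) v = act g (act h v)"
  using G by (simp add: GL_module_def)

lemma act_one: "act (1\<^sub>m n) v = v"
  using G by (simp add: GL_module_def)

lemma functional_embed_N:
  assumes "u \<in> N_grp r" "r \<le> n"
  shows "l (act (embed_tl n u) v) = psiN chi r u * l v"
  using assms
proof (induction r arbitrary: u)
  case 0
  have "embed_tl n u = 1\<^sub>m n" using 0 by (intro eq_matI) (auto simp: embed_tl_def N_grp_def)
  then show ?case by (simp add: act_one psiN_def)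
next
  case (Suc r)
  let ?z = "vec r (\<lambda>i. u $$ (i, r))" and ?v = "mat r r (\<lambda>ij. u $$ ij)"
  note d = N_grp_Suc_embed[OF Suc.prems]
  have r: "r < n" using Suc.prems by simp
  have "embed_tl n ?v \<in> GL n" using d(2) N_GL r by (intro embed_tl_GL) auto
  then have "l (act (embed_tl n u) v) = l (act (col_unip n r ?z) (act (embed_tl n ?v) v))"
    unfolding d(1) by (subst act_mult) auto
  also have "\<dots> = (if r = 0 then 1 else chi (?z $ (r - 1))) * l (act (embed_tl n ?v) v)"
  proof (cases "r = 0")
    case True
    then have "?z = 0\<^sub>v 0" by auto
    then have "col_unip n r ?z = 1\<^sub>m n" using col_unip_zero[of n 0] True by simp
    then show ?thesis using True by (simp add: act_one)
  next
    case False
    then show ?thesis using functional_col_unip[of r ?z] r by simp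
  qed
  also have "l (act (embed_tl n ?v) v) = psiN chi r ?v * l v" using Suc.IH[OF d(2)] r by simp
  also have "(if r = 0 then 1 else chi (?z $ (r - 1))) * (psiN chi r ?v * l v) = psiN chi (Suc r) u * l v"
  proof (cases r)
    case 0
    then show ?thesis by (simp add: psiN_def)
  next
    case (Suc k)
    then show ?thesis by (simp add: psiN_def chi_add mult_ac)
  qed
  finally show ?case .
qed

text \<open>Only \<open>W_top\<close> needs an argument: a functional on the model pulls back along
  V -> W to a functional L on V that kills every generator of the kernel of V -> V^(n). That kernel
  is the zero set of l, and f(1) = l(v) when f is the image of v.\<close>

lemma whittaker_model_space: "whittaker_space chi n (whittaker_model n act l)"
proof -
  let ?w = "whittaker_fun n act l"
  have l_add: "l (x + y) = l x + l y" and l_sc: "l (sc a x) = a * l x" and l_surj: "surj l"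
    and l_ker: "{v. l v = 0} = deriv_kernel sc act chi n n UNIV" for x y a
    using wl unfolding whittaker_functional_def by auto
  have a_add: "act g (x + y) = act g x + act g y" and a_sc: "act g (sc a x) = sc a (act g x)"
    if "g \<in> GL n" for g x y a
    using G that by (simp_all add: GL_module_def)
  have w_add: "?w (x + y) = ?w x + ?w y" for x y
    by (auto simp: whittaker_fun_def fun_eq_iff l_add a_add)
  have w_sc: "?w (sc a x) = fscale a (?w x)" for x a
    by (auto simp: whittaker_fun_def fun_eq_iff l_sc a_sc fscale_def)
  have w_tr: "transl n g (?w x) = ?w (act g x)" if "g \<in> GL n" for g x
    using that by (auto simp: whittaker_fun_def fun_eq_iff transl_def act_mult GL_mult)
  show ?thesis
  proof (unfold_locales, goal_cases)
    case (1 f g)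
    then show ?case by (auto simp: whittaker_model_def simp flip: w_add)
  next
    case (2 f a)
    then show ?case by (auto simp: whittaker_model_def simp flip: w_sc)
  next
    case (3 f g)
    then show ?case by (auto simp: whittaker_model_def w_tr)
  next
    case (4 f h)
    then show ?case by (auto simp: whittaker_model_def whittaker_fun_def)
  next
    case (5 f u h)
    have "embed_tl n u = u" using 5(2) by (intro eq_matI) (auto simp: embed_tl_def N_grp_def)
    then have "l (act u x) = psiN chi n u * l x" for x
      using functional_embed_N[OF 5(2), of x] by simp
    then show ?case using 5 N_GL[OF 5(2)]
      by (auto simp: whittaker_model_def whittaker_fun_def GL_mult act_mult)
  next
    case (6 a)
    obtain v where "l v = a" using l_surj by (metis surjD)
    then show ?case by (auto simp: whittaker_model_def whittaker_fun_def act_one intro!: exI[of _ v])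
  next
    case (7 \<phi> f)
    define L where "L v = \<phi> (?w v)" for v
    have wW: "?w v \<in> whittaker_model n act l" for v by (simp add: whittaker_model_def)
    have L_add: "L (x + y) = L x + L y" for x y unfolding L_def w_add using 7(1) wW by blast
    have L_sc: "L (sc a x) = a * L x" for x a unfolding L_def w_sc using 7(2) wW by blast
    have L0: "L 0 = 0" using L_sc[of 0 0] by simp
    have L_diff: "L (x - y) = L x - L y" for x y
      using L_add[of "x - y" y] by (simp add: algebra_simps)
    obtain v where v: "f = ?w v" using 7(4) by (auto simp: whittaker_model_def)
    then have "l v = 0" using 7(5) by (simp add: whittaker_fun_def act_one)
    then have vk: "v \<in> deriv_kernel sc act chi n n UNIV" using l_ker by blast
    have "L v = 0"
    proof (cases "n = 0")
      case True
      then show ?thesis using vk L0 by (simp add: deriv_kernel_def)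
    next
      case False
      let ?S = "{act (embed_tl n u) v - sc (psiU chi (n - j) u) v |j u v. j + 1 < n \<and> u \<in> U_grp (n - j) \<and> v \<in> UNIV}
         \<union> {act (embed_tl n u) v - v |u v. u \<in> U_grp (n - n + 1) \<and> v \<in> UNIV}"
      have "v \<in> V.span ?S" using vk False by (simp add: deriv_kernel_def)
      then show ?thesis
      proof (rule V.span_induct)
        show "V.subspace {v. L v = 0}" by (rule V.subspaceI) (auto simp: L0 L_add L_sc)
        fix x assume "x \<in> ?S"
        then consider (a) j u v where "x = act (embed_tl n u) v - sc (psiU chi (n - j) u) v"
            "j + 1 < n" "u \<in> U_grp (n - j)"
          | (b) u v where "x = act (embed_tl n u) v - v" "u \<in> U_grp 1" by auto
        then show "L x = 0"
        proof cases
          case a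
          define s where "s = n - j - 1"
          have s: "0 < s" "s < n" "n - j = Suc s" using a(2) by (auto simp: s_def)
          have u: "u \<in> U_grp (Suc s)" using a(3) s(3) by simp
          obtain z where z: "z \<in> carrier_vec s" "embed_tl n u = col_unip n s z"
            "0 < s \<Longrightarrow> u $$ (s - 1, s) = z $ (s - 1)" using U_grp_col_unip[OF u s(2)] by metis
          have "psiU chi (n - j) u = chi (z $ (s - 1))"
            using s z(3) by (simp add: psiU_def numeral_2_eq_2)
          moreover have "L (act (col_unip n s z) v) = chi (z $ (s - 1)) * L v"
            unfolding L_def using 7(3)[OF s(1,2) z(1) wW, of v] by (simp add: w_tr)
          ultimately show ?thesis using a(1) z(2) by (simp add: L_diff L_sc)
        next
          \<comment> \<open>The final Psi^- of the top derivative involves U_1, which is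
            trivial.\<close>
          case b
          obtain z where "z \<in> carrier_vec 0" "embed_tl n u = col_unip n 0 z"
            using U_grp_col_unip[of u 0 n] b(2) False by auto
          moreover then have "z = 0\<^sub>v 0" by auto
          ultimately have "embed_tl n u = 1\<^sub>m n" using col_unip_zero[of n 0] by simp
          then show ?thesis using b(1) by (simp add: act_one L0)
        qed
      qed
    qed
    then show ?case by (simp add: v L_def)
  qed
qed

end

section \<open>Functions equivariant under N_n on both sides, and their support\<close>

section \<open>Bessel functions\<close>

lemma transl_transl: "g \<in> GL n \<Longrightarrow> h \<in> GL n \<Longrightarrow> transl n g (transl n h f) = transl n (g * h) f"
  by (auto simp: transl_def fun_eq_iff GL_mult GL_carrier assoc_mult_mat[of _ n n _ n _ n])

lemma transl_add: "transl n g (f1 + f2) = transl n g f1 + transl n g f2"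
  by (auto simp: transl_def)

lemma transl_fscale: "transl n g (fscale a f) = fscale a (transl n g f)"
  by (auto simp: transl_def fscale_def)

lemma sum_function_apply: "(\<Sum>i\<in>A. f i) x = (\<Sum>i\<in>A. f i x)" for f :: "'i \<Rightarrow> 'b \<Rightarrow> 'a::comm_monoid_add"
  by (induction A rule: infinite_finite_induct) auto

context additive_character
begin

text \<open>The relation \<open>(1 + c g E\<^bsub>ab\<^esub>) g = g (1 + c E\<^bsub>ab\<^esub> g)\<close> compares the two equivariances at \<open>g\<close>.\<close>
lemma biequivariant_zero:
  fixes f :: "'k mat \<Rightarrow> 'a"
  assumes left: "\<And>u. u \<in> N_grp n \<Longrightarrow> f (u * g) = psiN chi n u * f g"
    and right: "\<And>u. u \<in> N_grp n \<Longrightarrow> f (g * u) = psiN chi n u * f g"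
    and g: "g \<in> carrier_mat n n" and ab: "a < b" "b < n"
    and col: "\<And>i. b \<le> i \<Longrightarrow> i < n \<Longrightarrow> g $$ (i,a) = 0"
    and row: "\<And>j. j \<le> a \<Longrightarrow> g $$ (b,j) = 0"
    and ne: "g $$ (b - 1, a) \<noteq> g $$ (b, a + 1)"
  shows "f g = 0"
proof (rule eq_zero_by_char)
  show "g $$ (b - 1, a) - g $$ (b, a + 1) \<noteq> 0" using ne by simp
  fix c :: 'k
  \<comment> \<open>v = 1 + c g E_ab and u = 1 + c E_ab g. The conditions \<open>col\<close> and
    \<open>row\<close> make both upper unipotent; their superdiagonals have at most one nonzero
    entry each, in row b - 1 for v and in row a for u.\<close>
  define v where "v = mat n n (\<lambda>(i,j). (if i = j then 1 else 0) + (if j = b then c * g $$ (i,a) else 0))"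
  define u where "u = mat n n (\<lambda>(i,j). (if i = j then 1 else 0) + (if i = a then c * g $$ (b,j) else 0))"
  have vc: "v \<in> carrier_mat n n" and uc: "u \<in> carrier_mat n n" by (auto simp: u_def v_def)
  have vN: "v \<in> N_grp n" using col by (auto simp: N_grp_def v_def)
  have uN: "u \<in> N_grp n" using row by (auto simp: N_grp_def u_def)
  have eq: "v * g = g * u"
  proof (rule eq_matI)
    fix i j assume "i < dim_row (g * u)" "j < dim_col (g * u)"
    then have ij: "i < n" "j < n" using g uc by auto
    have "(\<Sum>k<n. v $$ (i,k) * g $$ (k,j))
      = (\<Sum>k<n. (if k = i then g $$ (k,j) else 0) + (if k = b then c * g $$ (i,a) * g $$ (k,j) else 0))"
      using ij ab by (intro sum.cong) (auto simp: v_def algebra_simps)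
    then have "(v * g) $$ (i,j) = g $$ (i,j) + c * g $$ (i,a) * g $$ (b,j)"
      using index_mult_mat_sum[OF vc g ij] ij ab by (simp add: sum.distrib)
    moreover have "(\<Sum>k<n. g $$ (i,k) * u $$ (k,j))
      = (\<Sum>k<n. (if k = j then g $$ (i,k) else 0) + (if k = a then c * g $$ (i,k) * g $$ (b,j) else 0))"
      using ij ab by (intro sum.cong) (auto simp: u_def algebra_simps)
    then have "(g * u) $$ (i,j) = g $$ (i,j) + c * g $$ (i,a) * g $$ (b,j)"
      using index_mult_mat_sum[OF g uc ij] ij ab by (simp add: sum.distrib)
    ultimately show "(v * g) $$ (i,j) = (g * u) $$ (i,j)" by simp
  qed (use g uc vc in auto)
  have "(\<Sum>i<n - 1. v $$ (i,i+1)) = (\<Sum>i<n - 1. if i = b - 1 then c * g $$ (i,a) else 0)"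
    using ab by (intro sum.cong) (auto simp: v_def)
  then have pv: "psiN chi n v = chi (c * g $$ (b - 1, a))" using ab by (auto simp: psiN_def)
  have "(\<Sum>i<n - 1. u $$ (i,i+1)) = (\<Sum>i<n - 1. if i = a then c * g $$ (b,i+1) else 0)"
    using ab by (intro sum.cong) (auto simp: u_def)
  then have pu: "psiN chi n u = chi (c * g $$ (b, a + 1))" using ab by (auto simp: psiN_def)
  have "chi (c * g $$ (b - 1, a)) * f g = chi (c * g $$ (b, a + 1)) * f g"
    using left[OF vN] right[OF uN] eq pv pu by simp
  then have "chi (- (c * g $$ (b, a + 1))) * (chi (c * g $$ (b - 1, a)) * f g) = f g"
    by (simp add: chi_minus flip: mult.assoc)
  then have "chi (- (c * g $$ (b, a + 1)) + c * g $$ (b - 1, a)) * f g = f g"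
    by (simp only: chi_add mult.assoc)
  then show "f g = chi ((g $$ (b - 1, a) - g $$ (b, a + 1)) * c) * f g"
    by (simp add: algebra_simps)
qed

text \<open>Where f is nonzero, \<open>biequivariant_zero\<close> with a = j - 1 and b = i carries
  the entry at (i - 1, j - 1) over to (i, j), so the first column determines the entries on and
  below the diagonal, column by column.\<close>

lemma biequivariant_support_col:
  fixes f :: "'k mat \<Rightarrow> 'a"
  assumes left: "\<And>u. u \<in> N_grp n \<Longrightarrow> f (u * g) = psiN chi n u * f g"
    and right: "\<And>u. u \<in> N_grp n \<Longrightarrow> f (g * u) = psiN chi n u * f g"
    and g: "g \<in> carrier_mat n n"
    and first: "\<And>i. i < n \<Longrightarrow> g $$ (i,0) = (if i = 0 then 1 else 0)"
    and ne: "f g \<noteq> 0"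
  shows "g \<in> N_grp n"
proof -
  have "\<forall>i. j \<le> i \<longrightarrow> i < n \<longrightarrow> g $$ (i,j) = (if i = j then 1 else 0)" if "j < n" for j
    using that
  proof (induction j rule: less_induct)
    case (less j)
    show ?case
    proof (intro allI impI, rule ccontr)
      fix i assume i: "j \<le> i" "i < n" "g $$ (i,j) \<noteq> (if i = j then 1 else 0)"
      then have j: "0 < j" using first[of i] by (cases j) auto
      have IH: "g $$ (i',j') = (if i' = j' then 1 else 0)" if "j' < j" "j' \<le> i'" "i' < n" for i' j'
        using less.IH[of j'] that less.prems by auto
      have "f g = 0"
      proof (rule biequivariant_zero[OF left right g, of "j - 1" i])
        show "g $$ (i - 1, j - 1) \<noteq> g $$ (i, j - 1 + 1)"
          using IH[of "j - 1" "i - 1"] i j by (auto split: if_splits)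
      qed (use i j IH in auto)
      then show False using ne by simp
    qed
  qed
  then show ?thesis using g by (auto simp: N_grp_def)
qed

text \<open>The same propagation along diagonals, in the opposite direction: from row i + 1 to row
  i.\<close>

lemma biequivariant_support_row:
  fixes f :: "'k mat \<Rightarrow> 'a"
  assumes left: "\<And>u. u \<in> N_grp n \<Longrightarrow> f (u * g) = psiN chi n u * f g"
    and right: "\<And>u. u \<in> N_grp n \<Longrightarrow> f (g * u) = psiN chi n u * f g"
    and g: "g \<in> carrier_mat n n"
    and last: "\<And>j. j < n \<Longrightarrow> g $$ (n - 1,j) = (if j = n - 1 then 1 else 0)"
    and ne: "f g \<noteq> 0"
  shows "g \<in> N_grp n"
proof -
  \<comment> \<open>The induction climbs from the last row; d is the distance from it.\<close>
  have rows: "\<forall>j\<le>n - 1 - d. g $$ (n - 1 - d,j) = (if j = n - 1 - d then 1 else 0)" if "d < n" for d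
    using that
  proof (induction d rule: less_induct)
    case (less d)
    let ?i = "n - 1 - d"
    show ?case
    proof (intro allI impI, rule ccontr)
      fix j assume j: "j \<le> ?i" "g $$ (?i,j) \<noteq> (if j = ?i then 1 else 0)"
      have jn: "j < n" using j(1) less.prems by simp
      have d: "0 < d" using jn j last[of j] less.prems by (cases "d = 0") auto
      have IH: "g $$ (i',j') = (if j' = i' then 1 else 0)" if "?i < i'" "i' < n" "j' \<le> i'" for i' j'
      proof -
        have "n - 1 - (n - 1 - i') = i'" using that by simp
        then show ?thesis using less.IH[of "n - 1 - i'"] that less.prems by auto
      qed
      have "f g = 0"
      proof (rule biequivariant_zero[OF left right g, of j "?i + 1"])
        show "g $$ (?i + 1 - 1, j) \<noteq> g $$ (?i + 1, j + 1)"
          using IH[of "?i + 1" "j + 1"] j d less.prems by (auto split: if_splits)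
        show "g $$ (i,j) = 0" if "?i + 1 \<le> i" "i < n" for i using IH[of i j] that j by auto
        show "g $$ (?i + 1,j') = 0" if "j' \<le> j" for j'
          using IH[of "?i + 1" j'] that j d less.prems by auto
      qed (use j d less.prems in auto)
      then show False using ne by simp
    qed
  qed
  have "g $$ (i,j) = (if j = i then 1 else 0)" if "i < n" "j \<le> i" for i j
  proof -
    have "n - 1 - (n - 1 - i) = i" using that by simp
    then show ?thesis using rows[of "n - 1 - i"] that by auto
  qed
  then show ?thesis using g by (auto simp: N_grp_def)
qed

end

context whittaker_space
begin

lemma W_nonempty: "\<exists>f. f \<in> W"
  using W_value by blast

lemma W_zero: "0 \<in> W"
proof -
  obtain f where "f \<in> W" using W_nonempty by blast
  moreover have "fscale 0 f = 0" by (auto simp: fscale_def)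
  ultimately show ?thesis using W_scale by metis
qed

lemma W_sum: "finite A \<Longrightarrow> (\<And>i. i \<in> A \<Longrightarrow> F i \<in> W) \<Longrightarrow> (\<Sum>i\<in>A. F i) \<in> W"
  by (induction A rule: finite_induct) (auto simp: W_zero W_add)

lemma transl_one: "f \<in> W \<Longrightarrow> transl n (1\<^sub>m n) f = f"
  by (auto simp: transl_def fun_eq_iff W_off GL_carrier right_mult_one_mat[of _ n n])

text \<open>Averaging the right translates of f0 over N_n against the inverse of psi projects to the
  psi-isotypic part.\<close>

lemma bessel_exists:
  "\<exists>f\<in>W. f (1\<^sub>m n) = 1 \<and> (\<forall>u\<in>N_grp n. transl n u f = fscale (psiN chi n u) f)"
proof -
  let ?N = "N_grp n :: 'k mat set"
  obtain c where c: "of_nat (card ?N) * c = (1::'a)"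
    using card_N_unit[of n] by (auto simp: dvd_def)
  \<comment> \<open>At 1 the left equivariance of f0 cancels the inverse character, so each of the
    |N_n| summands is f0(1); the value c = 1/|N_n| makes the total 1.\<close>
  obtain f0 where f0: "f0 \<in> W" "f0 (1\<^sub>m n) = c" using W_value by blast
  define r where "r u = psiN (psi_inv chi) n u" for u
  have r_inv: "r u * psiN chi n u = 1" for u by (simp add: r_def psiN_psi_inv)
  define f where "f = (\<Sum>u\<in>?N. fscale (r u) (transl n u f0))"
  have fW: "f \<in> W" unfolding f_def using f0
    by (intro W_sum W_scale W_transl finite_N) (auto intro: N_GL)
  have f_val: "f x = (\<Sum>u\<in>?N. r u * f0 (x * u))" if "x \<in> GL n" for x
    using that by (simp add: f_def sum_function_apply fscale_def transl_def)
  have "f (1\<^sub>m n) = (\<Sum>u\<in>?N. c)"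
    unfolding f_val[OF GL_one]
  proof (rule sum.cong)
    fix u assume u: "u \<in> ?N"
    have "f0 (1\<^sub>m n * u) = f0 (u * 1\<^sub>m n)"
      using u N_carrier[OF u] left_mult_one_mat[of u n n] right_mult_one_mat[of u n n] by simp
    also have "\<dots> = psiN chi n u * c" using W_equiv[OF f0(1) u GL_one] f0(2) by simp
    finally show "r u * f0 (1\<^sub>m n * u) = c" using r_inv[of u] by (simp flip: mult.assoc)
  qed simp
  then have "f (1\<^sub>m n) = 1" using c by simp
  moreover have "transl n v f = fscale (psiN chi n v) f" if v: "v \<in> ?N" for v
  proof
    fix x
    show "transl n v f x = fscale (psiN chi n v) f x"
    proof (cases "x \<in> GL n")
      case False
      then show ?thesis using W_off[OF fW] by (simp add: transl_def fscale_def)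
    next
      case True
      have xv: "x * v \<in> GL n" using True N_GL[OF v] by (rule GL_mult)
      have "f (x * v) = (\<Sum>u\<in>?N. psiN chi n v * (r (v * u) * f0 (x * (v * u))))"
        unfolding f_val[OF xv]
      proof (rule sum.cong)
        fix u assume u: "u \<in> ?N"
        have 1: "r (v * u) * psiN chi n (v * u) = 1" by (rule r_inv)
        have "r u = r u * (r (v * u) * (psiN chi n v * psiN chi n u))"
          using 1 psiN_mult[OF v u] by simp
        also have "\<dots> = psiN chi n v * r (v * u) * (r u * psiN chi n u)" by (simp only: mult_ac)
        finally have "r u = psiN chi n v * r (v * u)" by (simp add: r_inv)
        moreover have "x * v * u = x * (v * u)"
          using True u v by (intro assoc_mult_mat[of _ n n _ n _ n]) (auto simp: GL_carrier N_carrier)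
        ultimately show "r u * f0 (x * v * u) = psiN chi n v * (r (v * u) * f0 (x * (v * u)))"
          by (simp add: mult.assoc)
      qed simp
      also have "\<dots> = (\<Sum>u\<in>?N. psiN chi n v * (r u * f0 (x * u)))"
        by (rule sum.reindex_bij_betw[OF N_bij_left[OF v], of "\<lambda>u. psiN chi n v * (r u * f0 (x * u))"])
      also have "\<dots> = psiN chi n v * f x" by (simp add: f_val[OF True] sum_distrib_left)
      finally show ?thesis using True by (simp add: transl_def fscale_def)
    qed
  qed
  ultimately show ?thesis using fW by blast
qed

end

section \<open>Derivatives, lowering the level of a form, and uniqueness of invariant forms\<close>

section \<open>Descent of invariant forms\<close>

lemma fscale_module: "Modules.module (fscale :: 'a::comm_ring_1 \<Rightarrow> ('k mat \<Rightarrow> 'a) \<Rightarrow> _)"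
  by unfold_locales (auto simp: fscale_def algebra_simps)

text \<open>The generators of the kernel of W -> W^(n-t) come from U_{s+1} with psi, for s > t, and
  from U_{t+1} with the trivial character; the hypotheses match them one by one. As phi is additive
  on W only, the induction over the span carries membership in W along.\<close>

lemma (in whittaker_space) deriv_kernel_vanish:
  fixes \<phi> :: "('k mat \<Rightarrow> 'a) \<Rightarrow> 'a"
  assumes add: "\<And>f g. f \<in> W \<Longrightarrow> g \<in> W \<Longrightarrow> \<phi> (f + g) = \<phi> f + \<phi> g"
    and sc: "\<And>a f. f \<in> W \<Longrightarrow> \<phi> (fscale a f) = a * \<phi> f"
    and upper: "\<And>s z f. t < s \<Longrightarrow> s < n \<Longrightarrow> z \<in> carrier_vec s \<Longrightarrow> f \<in> W
        \<Longrightarrow> \<phi> (transl n (col_unip n s z) f) = chi (z $ (s - 1)) * \<phi> f"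
    and inv: "\<And>y f. y \<in> carrier_vec t \<Longrightarrow> f \<in> W \<Longrightarrow> \<phi> (transl n (col_unip n t y) f) = \<phi> f"
    and t: "t < n" and f: "f \<in> deriv_kernel fscale (transl n) chi n (n - t) W"
  shows "\<phi> f = 0"
proof -
  have sc0: "fscale 0 h = 0" for h :: "'k mat \<Rightarrow> 'a" by (auto simp: fscale_def)
  have phi0: "\<phi> 0 = 0" using sc[of 0 0] W_zero sc0 by simp
  have diff: "x - y = x + fscale (- 1) y" for x y :: "'k mat \<Rightarrow> 'a" by (auto simp: fscale_def)
  have phi_diff: "x - y \<in> W \<and> \<phi> (x - y) = \<phi> x - \<phi> y" if "x \<in> W" "y \<in> W" for x y
    unfolding diff using that by (simp add: W_add W_scale add sc)
  interpret F: Modules.module "fscale :: 'a \<Rightarrow> ('k mat \<Rightarrow> 'a) \<Rightarrow> _" by (rule fscale_module)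
  let ?S = "{transl n (embed_tl n u) v - fscale (psiU chi (n - j) u) v |j u v. j + 1 < n - t \<and> u \<in> U_grp (n - j) \<and> v \<in> W}
     \<union> {transl n (embed_tl n u) v - v |u v. u \<in> U_grp (n - (n - t) + 1) \<and> v \<in> W}"
  have "f \<in> F.span ?S" using f t by (simp add: deriv_kernel_def)
  then have "f \<in> W \<and> \<phi> f = 0"
  proof (rule F.span_induct)
    show "F.subspace {f. f \<in> W \<and> \<phi> f = 0}"
      by (rule F.subspaceI) (auto simp: phi0 W_zero add sc W_add W_scale)
    fix x assume "x \<in> ?S"
    then consider (a) j u v where "x = transl n (embed_tl n u) v - fscale (psiU chi (n - j) u) v"
        "j + 1 < n - t" "u \<in> U_grp (n - j)" "v \<in> W"
      | (b) u v where "x = transl n (embed_tl n u) v - v" "u \<in> U_grp (Suc t)" "v \<in> W" using t by auto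
    then show "x \<in> W \<and> \<phi> x = 0"
    proof cases
      case a
      define s where "s = n - j - 1"
      have s: "t < s" "s < n" "n - j = Suc s" using a(2) by (auto simp: s_def)
      have u: "u \<in> U_grp (Suc s)" using a(3) s(3) by simp
      obtain z where z: "z \<in> carrier_vec s" "embed_tl n u = col_unip n s z"
        "0 < s \<Longrightarrow> u $$ (s - 1, s) = z $ (s - 1)" using U_grp_col_unip[OF u s(2)] by metis
      have "psiU chi (n - j) u = chi (z $ (s - 1))"
        using s z(3) by (simp add: psiU_def numeral_2_eq_2)
      then have x: "x = transl n (col_unip n s z) v - fscale (chi (z $ (s - 1))) v" using a(1) z(2) by simp
      show ?thesis unfolding x
        using phi_diff[OF W_transl[OF a(4) col_unip_GL[of n s z]] W_scale[OF a(4)], of "chi (z $ (s - 1))"]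
          upper[OF s(1,2) z(1) a(4)] sc[OF a(4), of "chi (z $ (s - 1))"] by simp
    next
      case b
      obtain z where z: "z \<in> carrier_vec t" "embed_tl n u = col_unip n t z"
        using U_grp_col_unip[OF b(2) t] by metis
      show ?thesis unfolding b(1) z(2)
        using phi_diff[OF W_transl[OF b(3) col_unip_GL[of n t z]] b(3)] inv[OF z(1) b(3)] by simp
    qed
  qed
  then show ?thesis by simp
qed

locale whittaker_pair = w1: whittaker_space chi n W + w2: whittaker_space "psi_inv chi" m W'
  for chi :: "'k::{field,finite} \<Rightarrow> 'a::comm_ring_1" and n m :: nat
    and W W' :: "('k mat \<Rightarrow> 'a) set" +
  assumes m_pos: "1 \<le> m" and m_less: "m < n"
begin

text \<open>These are the first three clauses of \<open>exceptional\<close>, so that a form can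
  serve as a witness there. Forms are functions on all pairs, hence the restriction to W and
  W'.\<close>

definition bilin :: "(('k mat \<Rightarrow> 'a) \<Rightarrow> ('k mat \<Rightarrow> 'a) \<Rightarrow> 'a) \<Rightarrow> bool" where
  "bilin B \<longleftrightarrow>
     (\<forall>f1\<in>W. \<forall>f2\<in>W. \<forall>g\<in>W'. B (f1 + f2) g = B f1 g + B f2 g)
   \<and> (\<forall>f\<in>W. \<forall>g1\<in>W'. \<forall>g2\<in>W'. B f (g1 + g2) = B f g1 + B f g2)
   \<and> (\<forall>a. \<forall>f\<in>W. \<forall>g\<in>W'. B (fscale a f) g = a * B f g \<and> B f (fscale a g) = a * B f g)"

text \<open>For \<open>t < m\<close> these are the \<open>P\<^bsub>t+1\<^esub>\<close>-invariant forms on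
  \<open>(\<Phi>\<^sup>-)\<^bsup>n-t-1\<^esup> W \<times> (\<Phi>\<^sup>-)\<^bsup>m-t-1\<^esup> W'\<close>,
  pulled back to \<open>W \<times> W'\<close>; for \<open>t = m\<close> the \<open>G\<^sub>m\<close>-invariant forms on
  \<open>(\<Phi>\<^sup>-)\<^bsup>n-m-1\<^esup> W \<times> W'\<close>.\<close>
definition form_level :: "nat \<Rightarrow> (('k mat \<Rightarrow> 'a) \<Rightarrow> ('k mat \<Rightarrow> 'a) \<Rightarrow> 'a) \<Rightarrow> bool" where
  "form_level t B \<longleftrightarrow> bilin B
   \<and> (\<forall>s z. t < s \<longrightarrow> s < n \<longrightarrow> z \<in> carrier_vec s \<longrightarrow> (\<forall>f\<in>W. \<forall>g\<in>W'.
        B (transl n (col_unip n s z) f) g = chi (z $ (s - 1)) * B f g))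
   \<and> (\<forall>s z. t < s \<longrightarrow> s < m \<longrightarrow> z \<in> carrier_vec s \<longrightarrow> (\<forall>f\<in>W. \<forall>g\<in>W'.
        B f (transl m (col_unip m s z) g) = psi_inv chi (z $ (s - 1)) * B f g))
   \<and> (\<forall>h\<in>GL t. \<forall>f\<in>W. \<forall>g\<in>W'. B (transl n (embed_tl n h) f) (transl m (embed_tl m h) g) = B f g)
   \<and> (t < m \<longrightarrow> (\<forall>y\<in>carrier_vec t. \<forall>f\<in>W. \<forall>g\<in>W'.
        B (transl n (col_unip n t y) f) (transl m (col_unip m t y) g) = B f g))"

text \<open>Up to the unit q^t, this composes B with the projection of its first argument to the
  psi-isotypic part under U_{t+1}. Without the normalisation no inverse in A has to be
  named.\<close>

definition lower :: "nat \<Rightarrow> (('k mat \<Rightarrow> 'a) \<Rightarrow> ('k mat \<Rightarrow> 'a) \<Rightarrow> 'a) \<Rightarrow> ('k mat \<Rightarrow> 'a) \<Rightarrow> ('k mat \<Rightarrow> 'a) \<Rightarrow> 'a" where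
  "lower t B f g = (\<Sum>y\<in>carrier_vec t. chi (- (y $ (t - 1))) * B (transl n (col_unip n t y) f) g)"

lemma bilinD:
  assumes "bilin B"
  shows "f1 \<in> W \<Longrightarrow> f2 \<in> W \<Longrightarrow> g \<in> W' \<Longrightarrow> B (f1 + f2) g = B f1 g + B f2 g"
    and "f \<in> W \<Longrightarrow> g1 \<in> W' \<Longrightarrow> g2 \<in> W' \<Longrightarrow> B f (g1 + g2) = B f g1 + B f g2"
    and "f \<in> W \<Longrightarrow> g \<in> W' \<Longrightarrow> B (fscale a f) g = a * B f g"
    and "f \<in> W \<Longrightarrow> g \<in> W' \<Longrightarrow> B f (fscale a g) = a * B f g"
  using assms by (simp_all add: bilin_def)

lemma form_levelD:
  assumes "form_level t B"
  shows "bilin B"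
    and "t < s \<Longrightarrow> s < n \<Longrightarrow> z \<in> carrier_vec s \<Longrightarrow> f \<in> W \<Longrightarrow> g \<in> W'
      \<Longrightarrow> B (transl n (col_unip n s z) f) g = chi (z $ (s - 1)) * B f g"
    and "t < s \<Longrightarrow> s < m \<Longrightarrow> z \<in> carrier_vec s \<Longrightarrow> f \<in> W \<Longrightarrow> g \<in> W'
      \<Longrightarrow> B f (transl m (col_unip m s z) g) = psi_inv chi (z $ (s - 1)) * B f g"
    and "h \<in> GL t \<Longrightarrow> f \<in> W \<Longrightarrow> g \<in> W'
      \<Longrightarrow> B (transl n (embed_tl n h) f) (transl m (embed_tl m h) g) = B f g"
    and "t < m \<Longrightarrow> y \<in> carrier_vec t \<Longrightarrow> f \<in> W \<Longrightarrow> g \<in> W'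
      \<Longrightarrow> B (transl n (col_unip n t y) f) (transl m (col_unip m t y) g) = B f g"
  using assms by (simp_all add: form_level_def)

text \<open>Conjugation by h moves the character y -> psi(y_{t-1}) to y -> psi((h y)_{t-1}). Values
  of \<open>lower\<close> at translates are thus Fourier coefficients of y -> B(u(y) f, g) at other
  characters.\<close>

lemma lower_embed:
  assumes B: "form_level t B" and t: "t \<le> m" and h: "h \<in> GL t" and f: "f \<in> W" and g: "g \<in> W'"
  shows "lower t B (transl n (embed_tl n h) f) (transl m (embed_tl m h) g)
    = (\<Sum>y\<in>carrier_vec t. chi (- ((h *\<^sub>v y) $ (t - 1))) * B (transl n (col_unip n t y) f) g)"
proof -
  have tn: "t < n" using t m_less by simp
  have eG: "embed_tl n h \<in> GL n" using embed_tl_GL[OF h] tn by simp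
  have "B (transl n (col_unip n t y) f) g
      = B (transl n (col_unip n t (h *\<^sub>v y)) (transl n (embed_tl n h) f)) (transl m (embed_tl m h) g)"
    if y: "y \<in> carrier_vec t" for y
  proof -
    have "B (transl n (col_unip n t y) f) g
        = B (transl n (embed_tl n h) (transl n (col_unip n t y) f)) (transl m (embed_tl m h) g)"
      using B h w1.W_transl[OF f col_unip_GL] g by (auto simp: form_level_def)
    also have "transl n (embed_tl n h) (transl n (col_unip n t y) f)
        = transl n (col_unip n t (h *\<^sub>v y)) (transl n (embed_tl n h) f)"
      using embed_tl_mult_col_unip[OF GL_carrier[OF h] y tn] eG by (simp add: transl_transl)
    finally show ?thesis .
  qed
  then have "(\<Sum>y\<in>carrier_vec t. chi (- ((h *\<^sub>v y) $ (t - 1))) * B (transl n (col_unip n t y) f) g)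
    = (\<Sum>y\<in>carrier_vec t. chi (- ((h *\<^sub>v y) $ (t - 1)))
        * B (transl n (col_unip n t (h *\<^sub>v y)) (transl n (embed_tl n h) f)) (transl m (embed_tl m h) g))"
    by (intro sum.cong) auto
  also have "\<dots> = lower t B (transl n (embed_tl n h) f) (transl m (embed_tl m h) g)"
    unfolding lower_def
    by (rule sum.reindex_bij_betw[OF GL_bij_vec[OF h], of "\<lambda>y. chi (- (y $ (t - 1)))
        * B (transl n (col_unip n t y) (transl n (embed_tl n h) f)) (transl m (embed_tl m h) g)"])
  finally show ?thesis by simp
qed

text \<open>Such an h fixes the character, hence the Fourier coefficient.\<close>

lemma lower_mirabolic:
  assumes B: "form_level t B" and t: "t \<le> m" and h: "h \<in> GL t" and f: "f \<in> W" and g: "g \<in> W'"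
    and last: "\<And>y. y \<in> carrier_vec t \<Longrightarrow> (h *\<^sub>v y) $ (t - 1) = y $ (t - 1)"
  shows "lower t B (transl n (embed_tl n h) f) (transl m (embed_tl m h) g) = lower t B f g"
  unfolding lower_embed[OF B t h f g] unfolding lower_def using last by (intro sum.cong) auto

lemma bilin_lower:
  assumes B: "bilin B"
  shows "bilin (lower t B)"
proof -
  have T: "transl n (col_unip n t y) f \<in> W" if "f \<in> W" for y f
    using w1.W_transl[OF that col_unip_GL] .
  have "lower t B (f1 + f2) g = lower t B f1 g + lower t B f2 g" if "f1 \<in> W" "f2 \<in> W" "g \<in> W'" for f1 f2 g
    using B T that by (simp add: lower_def transl_add bilin_def distrib_left sum.distrib)
  moreover have "lower t B f (g1 + g2) = lower t B f g1 + lower t B f g2" if "f \<in> W" "g1 \<in> W'" "g2 \<in> W'" for f g1 g2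
    using B T that by (simp add: lower_def bilin_def distrib_left sum.distrib)
  moreover have "lower t B (fscale a f) g = a * lower t B f g" "lower t B f (fscale a g) = a * lower t B f g"
    if "f \<in> W" "g \<in> W'" for a f g
    using B T that by (simp_all add: lower_def transl_fscale bilin_def sum_distrib_left mult.left_commute)
  ultimately show ?thesis unfolding bilin_def by blast
qed

lemma shift_bij:
  assumes "z \<in> carrier_vec t"
  shows "bij_betw (\<lambda>y. y + z) (carrier_vec t) (carrier_vec t :: 'k vec set)"
proof (rule bij_betw_byWitness[where f' = "\<lambda>v. v - z"])
  show "\<forall>v\<in>carrier_vec t. v + z - z = v" using assms by (intro ballI eq_vecI) auto
  show "\<forall>v\<in>carrier_vec t. v - z + z = v" using assms by (intro ballI eq_vecI) auto
qed (use assms in auto)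

text \<open>Equivariance at s = k + 1 is created by the projection. For larger s it is inherited
  from B: U_{k+2} lies in P_s, so it normalises U_{s+1} and fixes its character. Invariance under
  G_k and U_{k+1} is \<open>lower_mirabolic\<close>, both groups lying in P_{k+1}.\<close>

lemma form_level_lower:
  assumes B: "form_level (Suc k) B" and k: "Suc k \<le> m"
  shows "form_level k (lower (Suc k) B)"
proof -
  let ?t = "Suc k" and ?V = "carrier_vec (Suc k) :: 'k vec set"
  have tn: "?t < n" using k m_less by simp
  have bil: "bilin B" using B by (simp add: form_level_def)
  have L1: "lower ?t B (transl n (col_unip n s z) f) g = chi (z $ (s - 1)) * lower ?t B f g"
    if s: "k < s" "s < n" "z \<in> carrier_vec s" and f: "f \<in> W" and g: "g \<in> W'" for s z f g
  proof (cases "s = ?t")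
    case True
    have z: "z \<in> ?V" using s True by simp
    have "lower ?t B (transl n (col_unip n s z) f) g
      = (\<Sum>y\<in>?V. chi (z $ k) * (chi (- ((y + z) $ k)) * B (transl n (col_unip n ?t (y + z)) f) g))"
      unfolding lower_def True
    proof (rule sum.cong)
      fix y assume y: "y \<in> ?V"
      have "chi (- (y $ k)) = chi (z $ k + - ((y + z) $ k))" using y z by simp
      also have "\<dots> = chi (z $ k) * chi (- ((y + z) $ k))" by (rule w1.chi_add)
      finally show "chi (- (y $ (?t - 1))) * B (transl n (col_unip n ?t y) (transl n (col_unip n ?t z) f)) g
          = chi (z $ k) * (chi (- ((y + z) $ k)) * B (transl n (col_unip n ?t (y + z)) f) g)"
        using y z tn by (simp add: transl_transl col_unip_add mult.assoc)
    qed simp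
    also have "\<dots> = (\<Sum>y\<in>?V. chi (z $ k) * (chi (- (y $ k)) * B (transl n (col_unip n ?t y) f) g))"
      by (rule sum.reindex_bij_betw[OF shift_bij[OF z],
          of "\<lambda>y. chi (z $ k) * (chi (- (y $ k)) * B (transl n (col_unip n ?t y) f) g)"])
    finally show ?thesis using True by (simp add: lower_def sum_distrib_left)
  next
    case False
    then have ts: "?t < s" using s by simp
    have "B (transl n (col_unip n ?t y) (transl n (col_unip n s z) f)) g
        = chi (z $ (s - 1)) * B (transl n (col_unip n ?t y) f) g" if y: "y \<in> ?V" for y
    proof -
      let ?z = "col_unip s ?t y *\<^sub>v z"
      have "col_unip n ?t y * col_unip n s z = col_unip n s ?z * col_unip n ?t y"
        using embed_tl_mult_col_unip[OF col_unip_carrier[of s ?t y] s(3,2)]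
          embed_tl_col_unip[OF ts, of n y] s(2) by simp
      then have "transl n (col_unip n ?t y) (transl n (col_unip n s z) f)
          = transl n (col_unip n s ?z) (transl n (col_unip n ?t y) f)" by (simp add: transl_transl)
      moreover have "?z \<in> carrier_vec s" using mult_mat_vec_carrier[OF col_unip_carrier s(3)] .
      ultimately have "B (transl n (col_unip n ?t y) (transl n (col_unip n s z) f)) g
          = chi (?z $ (s - 1)) * B (transl n (col_unip n ?t y) f) g"
        using B ts s(2) w1.W_transl[OF f col_unip_GL] g unfolding form_level_def by simp
      then show ?thesis using col_unip_mult_vec_last[OF ts s(3) y] by simp
    qed
    then have "lower ?t B (transl n (col_unip n s z) f) g
        = (\<Sum>y\<in>?V. chi (z $ (s - 1)) * (chi (- (y $ k)) * B (transl n (col_unip n ?t y) f) g))"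
      unfolding lower_def by (intro sum.cong) (auto simp: mult_ac)
    then show ?thesis by (simp add: lower_def sum_distrib_left)
  qed
  have L2: "lower ?t B f (transl m (col_unip m s z) g) = psi_inv chi (z $ (s - 1)) * lower ?t B f g"
    if s: "k < s" "s < m" "z \<in> carrier_vec s" and f: "f \<in> W" and g: "g \<in> W'" for s z f g
  proof (cases "s = ?t")
    case True
    have z: "z \<in> ?V" using s True by simp
    have tm: "?t < m" using True s by simp
    have "lower ?t B f (transl m (col_unip m s z) g)
      = (\<Sum>y\<in>?V. chi (- ((y + z) $ k)) * B (transl n (col_unip n ?t (y + z)) f) (transl m (col_unip m s z) g))"
      unfolding lower_def
      using sum.reindex_bij_betw[OF shift_bij[OF z],
          of "\<lambda>y. chi (- (y $ k)) * B (transl n (col_unip n ?t y) f) (transl m (col_unip m s z) g)"] by simp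
    also have "\<dots> = (\<Sum>y\<in>?V. psi_inv chi (z $ k) * (chi (- (y $ k)) * B (transl n (col_unip n ?t y) f) g))"
    proof (rule sum.cong)
      fix y assume y: "y \<in> ?V"
      have "chi (- ((y + z) $ k)) = chi (- (z $ k) + - (y $ k))" using y z by (simp add: algebra_simps)
      also have "\<dots> = psi_inv chi (z $ k) * chi (- (y $ k))" unfolding psi_inv_def by (rule w1.chi_add)
      finally have c: "chi (- ((y + z) $ k)) = psi_inv chi (z $ k) * chi (- (y $ k))" .
      \<comment> \<open>With z split off as the outer translation, the invariance of B under U_{k+2}
        acting on both arguments removes it; that clause is available because k + 1 < m.\<close>
      have "y + z = z + y" using y z by (rule comm_add_vec)
      then have "transl n (col_unip n ?t (y + z)) f = transl n (col_unip n ?t z) (transl n (col_unip n ?t y) f)"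
        using y z tn by (simp add: transl_transl col_unip_add)
      then have "B (transl n (col_unip n ?t (y + z)) f) (transl m (col_unip m s z) g)
          = B (transl n (col_unip n ?t y) f) g"
        using B tm z w1.W_transl[OF f col_unip_GL] g True unfolding form_level_def by simp
      then show "chi (- ((y + z) $ k)) * B (transl n (col_unip n ?t (y + z)) f) (transl m (col_unip m s z) g)
          = psi_inv chi (z $ k) * (chi (- (y $ k)) * B (transl n (col_unip n ?t y) f) g)"
        using c by (simp only: mult.assoc)
    qed simp
    finally show ?thesis using True by (simp add: lower_def sum_distrib_left)
  next
    case False
    then have ts: "?t < s" using s by simp
    have "B (transl n (col_unip n ?t y) f) (transl m (col_unip m s z) g)
        = psi_inv chi (z $ (s - 1)) * B (transl n (col_unip n ?t y) f) g" for y
      using B ts s w1.W_transl[OF f col_unip_GL] g unfolding form_level_def by simp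
    then show ?thesis by (simp add: lower_def sum_distrib_left mult_ac)
  qed
  have L3: "lower ?t B (transl n (embed_tl n h) f) (transl m (embed_tl m h) g) = lower ?t B f g"
    if h: "h \<in> GL k" and f: "f \<in> W" and g: "g \<in> W'" for h f g
  proof -
    have "embed_tl n (embed_tl ?t h) = embed_tl n h" "embed_tl m (embed_tl ?t h) = embed_tl m h"
      using tn k by (auto intro!: embed_tl_embed_tl[OF GL_carrier[OF h]])
    moreover have "embed_tl ?t h \<in> GL ?t" using embed_tl_GL[OF h, of ?t] by simp
    moreover have "(embed_tl ?t h *\<^sub>v y) $ (?t - 1) = y $ (?t - 1)" if "y \<in> ?V" for y
      using embed_tl_mult_vec_last[OF _ that GL_carrier[OF h]] by simp
    ultimately show ?thesis using lower_mirabolic[OF B k _ f g, of "embed_tl ?t h"] by simp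
  qed
  have L4: "lower ?t B (transl n (col_unip n k y) f) (transl m (col_unip m k y) g) = lower ?t B f g"
    if y: "y \<in> carrier_vec k" and f: "f \<in> W" and g: "g \<in> W'" for y f g
  proof -
    have "embed_tl n (col_unip ?t k y) = col_unip n k y" "embed_tl m (col_unip ?t k y) = col_unip m k y"
      using tn k by (auto intro!: embed_tl_col_unip)
    moreover have "(col_unip ?t k y *\<^sub>v z) $ (?t - 1) = z $ (?t - 1)" if "z \<in> ?V" for z
      using col_unip_mult_vec_last[OF _ that y] by simp
    ultimately show ?thesis using lower_mirabolic[OF B k _ f g, of "col_unip ?t k y"] by simp
  qed
  show ?thesis
    unfolding form_level_def using bilin_lower[OF bil] L1 L2 L3 L4 by blast
qed

text \<open>Invariance of the first argument under U_{t+1}, combined with the diagonal invariance,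
  gives invariance of the second, so B factors through both derivatives. If it were nonzero,
  \<open>exceptional\<close> would hold with witness B.\<close>

lemma nonexceptional_zero:
  assumes nex: "\<not> exceptional n m chi W W'" and t: "1 \<le> t" "t \<le> m" and B: "form_level t B"
    and inv: "\<And>y f g. y \<in> carrier_vec t \<Longrightarrow> f \<in> W \<Longrightarrow> g \<in> W' \<Longrightarrow> B (transl n (col_unip n t y) f) g = B f g"
    and f: "f \<in> W" and g: "g \<in> W'"
  shows "B f g = 0"
proof (rule ccontr)
  assume ne: "B f g \<noteq> 0"
  have tn: "t < n" using t m_less by simp
  have bil: "bilin B" using B by (simp add: form_level_def)
  have K1: "B f g = 0" if "f \<in> deriv_kernel fscale (transl n) chi n (n - t) W" and g: "g \<in> W'" for f g
  proof (rule w1.deriv_kernel_vanish[where \<phi> = "\<lambda>f. B f g" and t = t])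
    show "B (transl n (col_unip n s z) f) g = chi (z $ (s - 1)) * B f g"
      if "t < s" "s < n" "z \<in> carrier_vec s" "f \<in> W" for s z f
      using form_levelD(2)[OF B] that g by blast
  qed (use bilinD[OF bil] inv g tn that in auto)
  have inv': "B f (transl m (col_unip m t y) g) = B f g"
    if "t < m" and y: "y \<in> carrier_vec t" and f: "f \<in> W" and g: "g \<in> W'" for y f g
  proof -
    have "B f (transl m (col_unip m t y) g)
        = B (transl n (col_unip n t y) f) (transl m (col_unip m t y) g)"
      using inv[OF y f w2.W_transl[OF g col_unip_GL[of m t y]]] by simp
    also have "\<dots> = B f g" by (rule form_levelD(5)[OF B that])
    finally show ?thesis .
  qed
  have K2: "B f g = 0" if f: "f \<in> W" and g: "g \<in> deriv_kernel fscale (transl m) (psi_inv chi) m (m - t) W'" for f g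
  proof (cases "t = m")
    \<comment> \<open>W'^(0) is W' itself, so for t = m the kernel is zero.\<close>
    case True
    then have "g = 0" using g by (simp add: deriv_kernel_def)
    moreover have "fscale 0 (0 :: 'k mat \<Rightarrow> 'a) = 0" by (auto simp: fscale_def)
    moreover have "B f (fscale 0 0) = 0 * B f 0" using bilinD(4)[OF bil f w2.W_zero] .
    ultimately show ?thesis by simp
  next
    case False
    then have tm: "t < m" using t by simp
    show ?thesis
    proof (rule w2.deriv_kernel_vanish[where \<phi> = "\<lambda>g. B f g" and t = t])
      show "B f (transl m (col_unip m s z) g) = psi_inv chi (z $ (s - 1)) * B f g"
        if "t < s" "s < m" "z \<in> carrier_vec s" "g \<in> W'" for s z g
        using form_levelD(3)[OF B] that f by blast
    qed (use bilinD[OF bil] inv' f g tm that in auto)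
  qed
  have "\<forall>h\<in>GL t. \<forall>f\<in>W. \<forall>g\<in>W'. B (transl n (embed_tl n h) f) (transl m (embed_tl m h) g) = B f g"
    using form_levelD(4)[OF B] by blast
  then have "exceptional n m chi W W'"
    unfolding exceptional_def
    by (intro bexI[of _ t] exI[of _ B] conjI)
      (use bil[unfolded bilin_def] K1 K2 t f g ne in \<open>assumption | blast | simp\<close>)+
  then show False using nex by simp
qed

text \<open>By \<open>lower_embed\<close> and \<open>GL_with_last_row\<close>, every Fourier
  coefficient of y -> B(u(y) f, g) at a nontrivial character is a value of \<open>lower\<close>. If
  all vanish, the function is constant, B is U_{t+1}-invariant in its first argument, and
  \<open>nonexceptional_zero\<close> applies.\<close>

lemma lower_injective:
  assumes nex: "\<not> exceptional n m chi W W'" and t: "1 \<le> t" "t \<le> m" and B: "form_level t B"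
    and low: "\<And>f g. f \<in> W \<Longrightarrow> g \<in> W' \<Longrightarrow> lower t B f g = 0"
    and f: "f \<in> W" and g: "g \<in> W'"
  shows "B f g = 0"
proof (rule nonexceptional_zero[OF nex t B _ f g])
  fix y :: "'k vec" and f g assume y: "y \<in> carrier_vec t" and f: "f \<in> W" and g: "g \<in> W'"
  have tn: "t < n" using t m_less by simp
  have "B (transl n (col_unip n t y) f) g = B (transl n (col_unip n t (0\<^sub>v t)) f) g"
  proof (rule w1.constant_if_fourier_vanish[OF _ y])
    fix v :: "'k vec" assume v: "v \<in> carrier_vec t" "v \<noteq> 0\<^sub>v t"
    obtain h where h: "h \<in> GL t" "\<And>y. y \<in> carrier_vec t \<Longrightarrow> (h *\<^sub>v y) $ (t - 1) = v \<bullet> y"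
      using GL_with_last_row[OF v] by blast
    have "embed_tl n h \<in> GL n" "embed_tl m h \<in> GL m" using embed_tl_GL[OF h(1)] t tn by auto
    then have "lower t B (transl n (embed_tl n h) f) (transl m (embed_tl m h) g) = 0"
      using low w1.W_transl[OF f] w2.W_transl[OF g] by blast
    then show "(\<Sum>y\<in>carrier_vec t. chi (- (v \<bullet> y)) * B (transl n (col_unip n t y) f) g) = 0"
      unfolding lower_embed[OF B t(2) h(1) f g] using h(2) by simp
  qed
  then show "B (transl n (col_unip n t y) f) g = B f g"
    using f by (simp add: col_unip_zero w1.transl_one)
qed

text \<open>Induction on the level. Elements of U_{t+1} only scale f1, so \<open>lower\<close>
  vanishes at (f1, g1) as well, and \<open>lower_injective\<close> carries the vanishing back up. At
  level 0, \<open>W_top\<close> in each argument gives B(f, g) = f(1) g(1) B(f1, g1). Of g1 only the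
  value at 1 matters.\<close>

lemma form_vanish:
  assumes nex: "\<not> exceptional n m chi W W'"
    and f1: "f1 \<in> W" "f1 (1\<^sub>m n) = 1" "\<And>u. u \<in> N_grp n \<Longrightarrow> transl n u f1 = fscale (psiN chi n u) f1"
    and g1: "g1 \<in> W'" "g1 (1\<^sub>m m) = 1"
    and "t \<le> m" "form_level t B" "B f1 g1 = 0" "f \<in> W" "g \<in> W'"
  shows "B f g = 0"
  using assms(7-)
proof (induction t arbitrary: B f g)
  case 0
  have bil: "bilin B" using 0 by (simp add: form_level_def)
  \<comment> \<open>f - f(1) f1 vanishes at 1, so a psi-equivariant functional kills it.\<close>
  have "B (f + fscale (- f (1\<^sub>m n)) f1) g = 0"
  proof (rule w1.W_top[where \<phi> = "\<lambda>f. B f g"])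
    show "B (transl n (col_unip n s z) f) g = chi (z $ (s - 1)) * B f g"
      if "0 < s" "s < n" "z \<in> carrier_vec s" "f \<in> W" for s z f
      using form_levelD(2)[OF 0(2)] that 0 by blast
    show "(f + fscale (- f (1\<^sub>m n)) f1) (1\<^sub>m n) = 0" using f1(2) by (simp add: fscale_def)
  qed (use bilinD[OF bil] 0 f1 in \<open>auto intro!: w1.W_add w1.W_scale\<close>)
  then have a: "B f g = f (1\<^sub>m n) * B f1 g"
    using 0 f1 w1.W_scale[OF f1(1)] by (simp add: bilinD[OF bil])
  have "B f1 (g + fscale (- g (1\<^sub>m m)) g1) = 0"
  proof (rule w2.W_top[where \<phi> = "\<lambda>g. B f1 g"])
    show "B f1 (transl m (col_unip m s z) g) = psi_inv chi (z $ (s - 1)) * B f1 g"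
      if "0 < s" "s < m" "z \<in> carrier_vec s" "g \<in> W'" for s z g
      using form_levelD(3)[OF 0(2)] that 0 f1(1) by blast
    show "(g + fscale (- g (1\<^sub>m m)) g1) (1\<^sub>m m) = 0" using g1(2) by (simp add: fscale_def)
  qed (use bilinD[OF bil] 0 f1 g1 in \<open>auto intro!: w2.W_add w2.W_scale\<close>)
  then have "B f1 g = g (1\<^sub>m m) * B f1 g1"
    using 0 f1 g1 w2.W_scale[OF g1(1)] by (simp add: bilinD[OF bil])
  then show ?case using a 0 by simp
next
  case (Suc k)
  have tn: "Suc k < n" using Suc.prems m_less by simp
  have bil: "bilin B" using Suc by (simp add: form_level_def)
  have "B (transl n (col_unip n (Suc k) y) f1) g1 = 0" for y
  proof -
    have "transl n (col_unip n (Suc k) y) f1 = fscale (psiN chi n (col_unip n (Suc k) y)) f1"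
      by (rule f1(3)[OF col_unip_N])
    then show ?thesis using f1(1) g1(1) Suc.prems(3) by (simp add: bilinD[OF bil])
  qed
  then have "lower (Suc k) B f1 g1 = 0" by (simp add: lower_def)
  then have "lower (Suc k) B f g = 0" if "f \<in> W" "g \<in> W'" for f g
    using Suc.IH[OF _ form_level_lower[OF Suc.prems(2,1)]] Suc.prems(1) that by simp
  then show ?case using lower_injective[OF nex _ Suc.prems(1,2)] Suc.prems by simp
qed

end

section \<open>Sums over cosets, and block matrix identities for \<open>gamma_mat\<close>\<close>

section \<open>The matrices of the functional equation\<close>

lemma one_N [simp]: "1\<^sub>m n \<in> N_grp n"
  by (auto simp: N_grp_def)

lemma N_inverse:
  assumes "u \<in> N_grp n"
  obtains w where "w \<in> N_grp n" "w * u = (1\<^sub>m n :: 'k::{field,finite} mat)"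
proof -
  obtain w where w: "w \<in> N_grp n" "1\<^sub>m n = u * w"
    using bij_betw_imp_surj_on[OF N_bij_left[OF assms]] one_N[of n] by (metis (no_types) imageE)
  then have "w * u = 1\<^sub>m n"
    using mat_mult_left_right_inverse[OF N_carrier[OF assms] N_carrier[OF w(1)]] by simp
  then show thesis using that w(1) by blast
qed

lemma N_coset_eq:
  assumes x: "x \<in> carrier_mat n n" and u: "u \<in> N_grp n"
  shows "{v * (u * x) | v. v \<in> N_grp n} = {v * x | v. v \<in> (N_grp n :: 'k::{field,finite} mat set)}"
proof (intro equalityI subsetI)
  fix y assume "y \<in> {v * (u * x) | v. v \<in> N_grp n}"
  then obtain v where v: "v \<in> N_grp n" "y = v * (u * x)" by blast
  then have "y = (v * u) * x" using x u by (simp add: assoc_mult_mat[of _ n n _ n _ n] N_carrier)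
  then show "y \<in> {v * x | v. v \<in> N_grp n}" using N_grp_mult(1)[OF v(1) u] by blast
next
  fix y assume "y \<in> {v * x | v. v \<in> N_grp n}"
  then obtain v where v: "v \<in> N_grp n" "y = v * x" by blast
  obtain w where w: "w \<in> N_grp n" "w * u = 1\<^sub>m n" using N_inverse[OF u] by blast
  have ux: "u * x \<in> carrier_mat n n" using mult_carrier_mat[OF N_carrier[OF u] x] .
  have "(v * w) * (u * x) = v * (w * (u * x))"
    by (rule assoc_mult_mat[OF N_carrier[OF v(1)] N_carrier[OF w(1)] ux])
  also have "w * (u * x) = (w * u) * x"
    by (rule assoc_mult_mat[OF N_carrier[OF w(1)] N_carrier[OF u] x, symmetric])
  also have "\<dots> = x" using w x by simp
  finally have "y = (v * w) * (u * x)" using v(2) by simp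
  then show "y \<in> {v * (u * x) | v. v \<in> N_grp n}" using N_grp_mult(1)[OF v(1) w(1)] by blast
qed

text \<open>Trades the chosen coset representatives for a sum over the whole group; the factor |N_m|
  is a unit of A and can be cancelled later.\<close>

lemma sum_NG_eq_sum_GL:
  fixes F :: "'k::{field,finite} mat \<Rightarrow> 'a::comm_ring_1"
  assumes inv: "\<And>u x. u \<in> N_grp m \<Longrightarrow> x \<in> GL m \<Longrightarrow> F (u * x) = F x"
  shows "of_nat (card (N_grp m :: 'k mat set)) * sum_NG m F = (\<Sum>x\<in>GL m. F x)"
proof -
  let ?N = "N_grp m :: 'k mat set" and ?R = "right_cosets_N m :: 'k mat set set"
  define co where "co x = {u * x | u. u \<in> ?N}" for x
  have R: "?R = co ` GL m" by (auto simp: right_cosets_N_def co_def)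
  have self: "x \<in> co x" if "x \<in> GL m" for x
    unfolding co_def mem_Collect_eq
    by (rule exI[of _ "1\<^sub>m m"]) (simp add: left_mult_one_mat[OF GL_carrier[OF that]])
  have co_eq: "co y = co x" if x: "x \<in> GL m" and y: "y \<in> co x" for x y
  proof -
    obtain u where "u \<in> ?N" "y = u * x" using y by (auto simp: co_def)
    then show ?thesis using N_coset_eq[OF GL_carrier[OF x]] by (simp add: co_def)
  qed
  have sub: "co x \<subseteq> GL m" if "x \<in> GL m" for x using that by (auto simp: co_def intro: GL_mult N_GL)
  have U: "\<Union>?R = GL m" using self sub by (auto simp: R)
  have disj: "\<forall>A\<in>?R. \<forall>B\<in>?R. A \<noteq> B \<longrightarrow> A \<inter> B = {}"
  proof (intro ballI impI, rule ccontr)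
    fix A B assume "A \<in> ?R" "B \<in> ?R" "A \<noteq> B" "A \<inter> B \<noteq> {}"
    then obtain x x' y where "x \<in> GL m" "x' \<in> GL m" "A = co x" "B = co x'" "y \<in> co x" "y \<in> co x'"
      by (auto simp: R)
    then show False using co_eq \<open>A \<noteq> B\<close> by metis
  qed
  have fin: "\<forall>A\<in>?R. finite A" by (auto simp: R intro: finite_subset[OF sub finite_GL])
  have coset: "(\<Sum>x\<in>C. F x) = of_nat (card ?N) * F (SOME x. x \<in> C)" if C: "C \<in> ?R" for C
  proof -
    obtain x where x: "x \<in> GL m" "C = co x" using C by (auto simp: R)
    have const: "F y = F x" if "y \<in> C" for y using that inv x by (auto simp: co_def)
    have "(SOME y. y \<in> C) \<in> C" using self[OF x(1)] x(2) by (metis someI)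
    then have s: "F (SOME y. y \<in> C) = F x" by (rule const)
    have "C = (\<lambda>u. u * x) ` ?N" using x(2) by (auto simp: co_def)
    moreover have "inj_on (\<lambda>u. u * x) ?N"
      using bij_betw_imp_inj_on[OF GL_bij_right[OF x(1)]] by (rule inj_on_subset) (auto intro: N_GL)
    ultimately have "card C = card ?N" by (simp add: card_image)
    moreover have "(\<Sum>x\<in>C. F x) = (\<Sum>y\<in>C. F x)" using const by (intro sum.cong) auto
    ultimately show ?thesis using s by simp
  qed
  have "(\<Sum>x\<in>GL m. F x) = (\<Sum>C\<in>?R. \<Sum>x\<in>C. F x)"
    using sum.Union_disjoint[OF fin disj, of F] by (simp add: U)
  also have "\<dots> = (\<Sum>C\<in>?R. of_nat (card ?N) * F (SOME x. x \<in> C))" using coset by (intro sum.cong) auto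
  finally show ?thesis by (simp add: sum_NG_def sum_distrib_left)
qed

text \<open>Serves to see left translation of x by N_m inside G_n: multiplying
  \<open>gamma_mat\<close> on the left by this matrix multiplies both x and y by u.\<close>

definition embed_br :: "nat \<Rightarrow> nat \<Rightarrow> 'k::field mat \<Rightarrow> 'k mat" where
  "embed_br n m u = mat n n (\<lambda>(i,j). if i < n - m \<or> j < n - m then (if i = j then 1 else 0)
      else u $$ (i - (n - m), j - (n - m)))"

lemma embed_tl_N_iff:
  assumes "x \<in> carrier_mat m m" "m \<le> n"
  shows "embed_tl n x \<in> N_grp n \<longleftrightarrow> x \<in> N_grp m"
proof
  assume e: "embed_tl n x \<in> N_grp n"
  have "x $$ (i,j) = embed_tl n x $$ (i,j)" if "i < m" "j < m" for i j
    using that assms by (simp add: embed_tl_def)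
  then show "x \<in> N_grp m" using e assms by (simp add: N_grp_def)
next
  assume "x \<in> N_grp m"
  then show "embed_tl n x \<in> N_grp n" using assms by (auto simp: N_grp_def embed_tl_def)
qed

lemma psiN_embed_tl:
  assumes "x \<in> carrier_mat m m" "m \<le> n"
  shows "psiN chi n (embed_tl n x) = psiN chi m x"
proof -
  have "(\<Sum>i<n - 1. embed_tl n x $$ (i, i + 1)) = (\<Sum>i<m - 1. x $$ (i, i + 1))"
    using assms by (intro sum.mono_neutral_cong_right) (auto simp: embed_tl_def)
  then show ?thesis by (simp add: psiN_def)
qed

lemma embed_br_N:
  assumes "x \<in> N_grp m"
  shows "embed_br n m x \<in> N_grp n"
  using assms by (auto simp: N_grp_def embed_br_def)

lemma psiN_embed_br:
  assumes "x \<in> carrier_mat m m" "m < n"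
  shows "psiN chi n (embed_br n m x) = psiN chi m x"
proof -
  have "(\<Sum>i<n - 1. embed_br n m x $$ (i, i + 1)) = (\<Sum>i\<in>{n - m..<n - 1}. embed_br n m x $$ (i, i + 1))"
    using assms by (intro sum.mono_neutral_right) (auto simp: embed_br_def)
  also have "\<dots> = (\<Sum>i<m - 1. x $$ (i, i + 1))"
    using assms
    by (intro sum.reindex_bij_witness[where i = "\<lambda>i. i + (n - m)" and j = "\<lambda>i. i - (n - m)"])
      (auto simp: embed_br_def Suc_diff_le)
  finally show ?thesis by (simp add: psiN_def)
qed

lemma gamma_mat_carrier [simp]: "gamma_mat n m x y \<in> carrier_mat n n"
  by (simp add: gamma_mat_def)

text \<open>Writing n = d + m avoids truncated subtraction, and row 0, treated apart in
  \<open>gamma_mat\<close>, obeys the same formula as the other rows of the upper block.\<close>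

lemma gamma_mat_top:
  assumes "i < d" "j < d + m"
  shows "gamma_mat (d + m) m x y $$ (i,j) = (if j = m + i then 1 else 0)"
  using assms by (auto simp: gamma_mat_def)

lemma gamma_mat_bottom:
  assumes "i < m" "j < d + m" "0 < d"
  shows "gamma_mat (d + m) m x y $$ (i + d,j)
    = (if j < m then x $$ (i,j) else if j = m then 0 else y $$ (i, j - m - 1))"
  using assms by (auto simp: gamma_mat_def)

lemma block_index_cases:
  assumes "i < d + m"
  obtains "i < d" | i' where "i' < m" "i = i' + (d::nat)"
proof (cases "i < d")
  case False
  then show thesis using that(2)[of "i - d"] assms by simp
qed (use that in auto)

lemma gamma_mat_embed_tl:
  assumes h: "h \<in> carrier_mat m m" and x: "x \<in> carrier_mat m m" and m: "m < n"
  shows "gamma_mat n m x y * embed_tl n h = gamma_mat n m (x * h) y"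
proof -
  obtain d where n: "n = d + m" and d: "0 < d" using m by (metis less_imp_add_positive add.commute)
  have mn: "m \<le> d + m" by simp
  show ?thesis unfolding n
  proof (rule eq_matI)
    fix i j assume "i < dim_row (gamma_mat (d + m) m (x * h) y)" "j < dim_col (gamma_mat (d + m) m (x * h) y)"
    then have ij: "i < d + m" "j < d + m" by (auto simp: gamma_mat_def)
    note e = mult_embed_tl_index[OF gamma_mat_carrier ij h mn]
    from ij(1) show "(gamma_mat (d + m) m x y * embed_tl (d + m) h) $$ (i,j)
        = gamma_mat (d + m) m (x * h) y $$ (i,j)"
    proof (cases rule: block_index_cases)
      case 1
      then show ?thesis unfolding e using ij by (auto simp: gamma_mat_top intro!: sum.neutral)
    next
      case (2 i')
      then show ?thesis unfolding e using ij d index_mult_mat_sum[OF x h 2(1)]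
        by (auto simp: gamma_mat_bottom intro!: sum.cong)
    qed
  qed (auto simp: gamma_mat_def embed_tl_def)
qed

lemma embed_br_mult_index:
  assumes "A \<in> carrier_mat (d + m) b" "j < b" "u \<in> carrier_mat m m"
  shows "i < d \<Longrightarrow> (embed_br (d + m) m u * A) $$ (i,j) = A $$ (i,j)"
    and "i < m \<Longrightarrow> (embed_br (d + m) m u * A) $$ (i + d,j) = (\<Sum>k<m. u $$ (i,k) * A $$ (k + d,j))"
proof -
  have c: "embed_br (d + m) m u \<in> carrier_mat (d + m) (d + m)" by (simp add: embed_br_def)
  note e = index_mult_mat_sum[OF c assms(1) _ assms(2)]
  show "(embed_br (d + m) m u * A) $$ (i,j) = A $$ (i,j)" if "i < d"
  proof -
    have "(\<Sum>k<d + m. embed_br (d + m) m u $$ (i,k) * A $$ (k,j)) = (\<Sum>k<d + m. if k = i then A $$ (k,j) else 0)"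
      using that by (intro sum.cong) (auto simp: embed_br_def)
    then show ?thesis using e[of i] that by simp
  qed
  show "(embed_br (d + m) m u * A) $$ (i + d,j) = (\<Sum>k<m. u $$ (i,k) * A $$ (k + d,j))" if "i < m"
  proof -
    have i: "i + d < d + m" using that by simp
    have "(\<Sum>k<d + m. embed_br (d + m) m u $$ (i + d,k) * A $$ (k,j))
        = (\<Sum>k\<in>{d..<d + m}. embed_br (d + m) m u $$ (i + d,k) * A $$ (k,j))"
      using i by (intro sum.mono_neutral_right) (auto simp: embed_br_def)
    also have "\<dots> = (\<Sum>k<m. u $$ (i,k) * A $$ (k + d,j))"
      using that i
      by (intro sum.reindex_bij_witness[where i = "\<lambda>i. i + d" and j = "\<lambda>i. i - d"])
        (auto simp: embed_br_def)
    finally show ?thesis using e[OF i] by simp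
  qed
qed

lemma embed_br_gamma_mat:
  assumes u: "u \<in> carrier_mat m m" and x: "x \<in> carrier_mat m m"
    and y: "y \<in> carrier_mat m (n - m - 1)" and m: "m < n"
  shows "embed_br n m u * gamma_mat n m x y = gamma_mat n m (u * x) (u * y)"
proof -
  obtain d where n: "n = d + m" and d: "0 < d" using m by (metis less_imp_add_positive add.commute)
  have y': "y \<in> carrier_mat m (d - 1)" using y by (simp add: n)
  show ?thesis unfolding n
  proof (rule eq_matI)
    fix i j assume "i < dim_row (gamma_mat (d + m) m (u * x) (u * y))"
      "j < dim_col (gamma_mat (d + m) m (u * x) (u * y))"
    then have ij: "i < d + m" "j < d + m" by (auto simp: gamma_mat_def)
    note e = embed_br_mult_index[OF gamma_mat_carrier ij(2) u]
    from ij(1) show "(embed_br (d + m) m u * gamma_mat (d + m) m x y) $$ (i,j)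
        = gamma_mat (d + m) m (u * x) (u * y) $$ (i,j)"
    proof (cases rule: block_index_cases)
      case 1
      then show ?thesis using ij by (simp add: e(1) gamma_mat_top)
    next
      case (2 i')
      have "(u * y) $$ (i', j - m - 1) = (\<Sum>k<m. u $$ (i',k) * y $$ (k, j - m - 1))" if "m < j"
        using index_mult_mat_sum[OF u y' 2(1)] that ij(2) by simp
      then show ?thesis using ij d 2 index_mult_mat_sum[OF u x 2(1)]
        by (auto simp: e(2) gamma_mat_bottom intro!: sum.cong)
    qed
  qed (auto simp: gamma_mat_def embed_br_def)
qed

text \<open>Right translation of \<open>gamma_mat\<close> by U_{s+1} changes its last m rows in
  column s only, which is column s - m - 1 of y. This records the new y.\<close>

definition shear :: "nat \<Rightarrow> nat \<Rightarrow> 'k::field mat \<Rightarrow> nat \<Rightarrow> 'k vec \<Rightarrow> 'k mat \<Rightarrow> 'k mat" where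
  "shear n m x s z y = mat m (n - m - 1) (\<lambda>(i,j). y $$ (i,j)
     + (if j = s - m - 1 then \<Sum>k<s. gamma_mat n m x y $$ (i + (n - m),k) * z $ k else 0))"

text \<open>In the upper block, row i is the unit vector at m + i, so the right factor adds z_{m+i}
  in column s for i < s - m. Row s - m is the unit vector at s, so a left factor in U_{s-m+1} has
  the same effect there; the change in the lower block is absorbed into y.\<close>

lemma gamma_mat_col_unip:
  assumes s: "m < s" "s < n"
  shows "gamma_mat n m x y * col_unip n s z
    = col_unip n (s - m) (vec (s - m) (\<lambda>i. z $ (m + i))) * gamma_mat n m x (shear n m x s z y)"
proof -
  obtain d where n: "n = d + m" and d: "0 < d" using s by (metis less_imp_add_positive add.commute less_trans)
  let ?z = "vec (s - m) (\<lambda>i. z $ (m + i))" and ?g = "gamma_mat (d + m) m x (shear (d + m) m x s z y)"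
  have sd: "s < d + m" using s n by simp
  show ?thesis unfolding n
  proof (rule eq_matI)
    fix i j assume "i < dim_row (col_unip (d + m) (s - m) ?z * ?g)" "j < dim_col (col_unip (d + m) (s - m) ?z * ?g)"
    then have ij: "i < d + m" "j < d + m" by (auto simp: gamma_mat_def col_unip_def)
    have sm: "s - m < d + m" using sd by simp
    have l: "(gamma_mat (d + m) m x y * col_unip (d + m) s z) $$ (i,j)
        = gamma_mat (d + m) m x y $$ (i,j) + (if j = s then \<Sum>k<s. gamma_mat (d + m) m x y $$ (i,k) * z $ k else 0)"
      by (rule mult_col_unip_index[OF gamma_mat_carrier ij sd])
    have r: "(col_unip (d + m) (s - m) ?z * ?g) $$ (i,j)
        = ?g $$ (i,j) + (if i < s - m then ?z $ i * ?g $$ (s - m,j) else 0)"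
      by (rule col_unip_mult_index[OF gamma_mat_carrier ij sm])
    have row: "?g $$ (s - m,j) = (if j = s then 1 else 0)"
      using s sd ij by (subst gamma_mat_top) auto
    from ij(1) show "(gamma_mat (d + m) m x y * col_unip (d + m) s z) $$ (i,j)
        = (col_unip (d + m) (s - m) ?z * ?g) $$ (i,j)"
    proof (cases rule: block_index_cases)
      case 1
      have "(\<Sum>k<s. gamma_mat (d + m) m x y $$ (i,k) * z $ k) = (\<Sum>k<s. if k = m + i then z $ k else 0)"
        using 1 sd by (intro sum.cong) (auto simp: gamma_mat_top)
      then show ?thesis unfolding l r row using 1 ij s by (auto simp: gamma_mat_top)
    next
      case (2 i')
      then have "\<not> i < s - m" using s sd by simp
      moreover have "j - Suc m = s - Suc m \<longleftrightarrow> j = s" if "m < j" using that s by auto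
      ultimately show ?thesis unfolding l r using 2 ij s d by (auto simp: gamma_mat_bottom shear_def)
    qed
  qed (auto simp: gamma_mat_def col_unip_def)
qed

text \<open>The altered column changes by an amount that depends only on x and on the columns of y
  to its left, which stay fixed. So the map is injective, on a finite set.\<close>

lemma shear_bij:
  assumes s: "m < s" "s < n"
  shows "bij_betw (shear n m x s z) (carrier_mat m (n - m - 1))
    (carrier_mat m (n - m - 1) :: 'k::{field,finite} mat set)"
proof -
  obtain d where n: "n = d + m" and d: "0 < d" using s by (metis less_imp_add_positive add.commute less_trans)
  let ?M = "carrier_mat m (d - 1) :: 'k mat set"
  have "inj_on (shear (d + m) m x s z) ?M"
  proof (rule inj_onI)
    fix y y' assume y: "y \<in> ?M" "y' \<in> ?M" and eq: "shear (d + m) m x s z y = shear (d + m) m x s z y'"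
    have ent: "y $$ (i,j) + (if j = s - m - 1 then \<Sum>k<s. gamma_mat (d + m) m x y $$ (i + d,k) * z $ k else 0)
       = y' $$ (i,j) + (if j = s - m - 1 then \<Sum>k<s. gamma_mat (d + m) m x y' $$ (i + d,k) * z $ k else 0)"
      if "i < m" "j < d - 1" for i j
      using arg_cong[OF eq, of "\<lambda>M. M $$ (i,j)"] that
      by (cases "j = s - m - 1") (simp_all add: shear_def)
    have other: "y $$ (i,j) = y' $$ (i,j)" if "i < m" "j < d - 1" "j \<noteq> s - m - 1" for i j
      using ent[OF that(1,2)] that(3) by simp
    have g: "(\<Sum>k<s. gamma_mat (d + m) m x y $$ (i + d,k) * z $ k)
        = (\<Sum>k<s. gamma_mat (d + m) m x y' $$ (i + d,k) * z $ k)" if i: "i < m" for i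
    proof (rule sum.cong)
      fix k assume "k \<in> {..<s}"
      then have k: "k < s" "k < d + m" using s n by auto
      have "y $$ (i, k - m - 1) = y' $$ (i, k - m - 1)" if "m < k"
        using other[OF i, of "k - m - 1"] k that s n by auto
      then show "gamma_mat (d + m) m x y $$ (i + d,k) * z $ k = gamma_mat (d + m) m x y' $$ (i + d,k) * z $ k"
        using gamma_mat_bottom[OF i k(2) d, of x y] gamma_mat_bottom[OF i k(2) d, of x y'] by auto
    qed simp
    have "y $$ (i,j) = y' $$ (i,j)" if "i < m" "j < d - 1" for i j
      using ent[OF that] g[OF that(1)] by (auto split: if_splits)
    then show "y = y'" using y by (intro eq_matI) auto
  qed
  moreover have "shear (d + m) m x s z ` ?M \<subseteq> ?M" by (auto simp: shear_def)
  ultimately have "bij_betw (shear (d + m) m x s z) ?M ?M"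
    using endo_inj_surj[OF finite_carrier_mat[of m "d - 1"]] by (simp add: bij_betw_def)
  then show ?thesis by (simp add: n)
qed

text \<open>Multiplying on the right by this permutation matrix moves the last n - m columns to the
  front. It turns \<open>gamma_mat\<close> into a block lower triangular matrix whose first column
  is that of the identity, as \<open>biequivariant_support_col\<close> requires.\<close>

definition block_swap :: "nat \<Rightarrow> nat \<Rightarrow> 'k::field mat" where
  "block_swap n m = mat n n (\<lambda>(a,j). if a = (if j < n - m then m + j else j - (n - m)) then 1 else 0)"

lemma gamma_mat_block_swap:
  assumes x: "x \<in> carrier_mat m m" and m: "m < n"
  shows "gamma_mat n m x y * block_swap n m
    = four_block_mat (1\<^sub>m (n - m)) (0\<^sub>m (n - m) m)
        (mat m (n - m) (\<lambda>(i,j). if j = 0 then 0 else y $$ (i, j - 1))) x"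
proof -
  obtain d where n: "n = d + m" and d: "0 < d" using m by (metis less_imp_add_positive add.commute)
  have c: "block_swap (d + m) m \<in> carrier_mat (d + m) (d + m)" by (simp add: block_swap_def)
  let ?F = "four_block_mat (1\<^sub>m d) (0\<^sub>m d m) (mat m d (\<lambda>(i,j). if j = 0 then 0 else y $$ (i, j - 1))) x"
  have "gamma_mat (d + m) m x y * block_swap (d + m) m = ?F"
  proof (rule eq_matI)
    fix i j assume "i < dim_row ?F" "j < dim_col ?F"
    then have ij: "i < d + m" "j < d + m" using x by auto
    define k where "k = (if j < d then m + j else j - d)"
    have k: "k < d + m" using ij by (auto simp: k_def)
    have "(gamma_mat (d + m) m x y * block_swap (d + m) m) $$ (i,j)
        = (\<Sum>a<d + m. gamma_mat (d + m) m x y $$ (i,a) * block_swap (d + m) m $$ (a,j))"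
      by (rule index_mult_mat_sum[OF gamma_mat_carrier c ij])
    also have "\<dots> = (\<Sum>a<d + m. if a = k then gamma_mat (d + m) m x y $$ (i,a) else 0)"
      using ij by (intro sum.cong) (auto simp: block_swap_def k_def)
    also have "\<dots> = gamma_mat (d + m) m x y $$ (i,k)" using k by simp
    also have "\<dots> = ?F $$ (i,j)"
      using ij(1)
    proof (cases rule: block_index_cases)
      case 1
      then show ?thesis using ij x gamma_mat_top[OF 1 k, of x y] by (auto simp: k_def)
    next
      case (2 i')
      then show ?thesis using ij x d gamma_mat_bottom[OF 2(1) k d, of x y] by (auto simp: k_def)
    qed
    finally show "(gamma_mat (d + m) m x y * block_swap (d + m) m) $$ (i,j) = ?F $$ (i,j)" .
  qed (use x in \<open>auto simp: gamma_mat_def block_swap_def\<close>)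
  then show ?thesis by (simp add: n)
qed

lemma gamma_mat_block_swap_zero:
  assumes x: "x \<in> carrier_mat m m" and m: "m < n"
  shows "gamma_mat n m x (0\<^sub>m m (n - m - 1)) * block_swap n m = embed_br n m x"
proof -
  obtain d where n: "n = d + m" and d: "0 < d" using m by (metis less_imp_add_positive add.commute)
  show ?thesis unfolding gamma_mat_block_swap[OF assms] unfolding n
    using x by (intro eq_matI) (auto simp: embed_br_def)
qed

text \<open>The product of the two matrices has determinant det x, which is nonzero, so both factors
  are invertible and neither determinant is computed.\<close>

lemma gamma_mat_GL:
  fixes x y :: "'k::field mat"
  assumes x: "x \<in> GL m" and m: "m < n"
  shows "(block_swap n m :: 'k mat) \<in> GL n" "gamma_mat n m x y \<in> GL n"
proof -
  have c: "(block_swap n m :: 'k mat) \<in> carrier_mat n n" by (simp add: block_swap_def)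
  have "det (gamma_mat n m x y * block_swap n m) = det x"
    unfolding gamma_mat_block_swap[OF GL_carrier[OF x] m]
    by (subst det_four_block_mat_upper_right_zero[of _ "n - m" _ m]) (use GL_carrier[OF x] in auto)
  then have "det (gamma_mat n m x y) * det (block_swap n m :: 'k mat) \<noteq> 0"
    using x det_mult[OF gamma_mat_carrier c, of m x y] by (simp add: GL_def)
  then show "(block_swap n m :: 'k mat) \<in> GL n" "gamma_mat n m x y \<in> GL n" using c by (auto simp: GL_def)
qed

lemma embed_tl_self: "h \<in> carrier_mat m m \<Longrightarrow> embed_tl m h = h"
  by (rule eq_matI) (auto simp: embed_tl_def)

lemma N_bij_mat:
  assumes "u \<in> N_grp m"
  shows "bij_betw (\<lambda>y. u * y) (carrier_mat m b) (carrier_mat m b :: 'k::{field,finite} mat set)"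
proof -
  obtain w where w: "w \<in> N_grp m" "w * u = 1\<^sub>m m" using N_inverse[OF assms] by blast
  have "inj_on (\<lambda>y. u * y) (carrier_mat m b)"
  proof (rule inj_on_inverseI[where g = "\<lambda>y. w * y"])
    fix y :: "'k mat" assume y: "y \<in> carrier_mat m b"
    have "w * (u * y) = (w * u) * y"
      by (rule assoc_mult_mat[OF N_carrier[OF w(1)] N_carrier[OF assms] y, symmetric])
    then show "w * (u * y) = y" using w y by simp
  qed
  moreover have "(\<lambda>y. u * y) ` carrier_mat m b \<subseteq> carrier_mat m b"
    using mult_carrier_mat[OF N_carrier[OF assms]] by blast
  ultimately show ?thesis
    using endo_inj_surj[OF finite_carrier_mat[of m b]] by (simp add: bij_betw_def)
qed

section \<open>Both sides as invariant forms, their values at Bessel functions, and gamma\<close>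

section \<open>The functional equation\<close>

lemma (in whittaker_space) W_col_unip:
  assumes "f \<in> W" "0 < s" "s < n" "h \<in> GL n"
  shows "f (col_unip n s z * h) = chi (z $ (s - 1)) * f h"
  using W_equiv[OF assms(1) col_unip_N assms(4)] by (simp add: psiN_col_unip[OF assms(2,3)])

lemma (in whittaker_space) W_N:
  assumes "f \<in> W" "u \<in> N_grp n"
  shows "f u = psiN chi n u * f (1\<^sub>m n)"
  using W_equiv[OF assms GL_one] right_mult_one_mat[OF N_carrier[OF assms(2)]] by simp

context whittaker_pair
begin

text \<open>Equals |N_m| times the sum over cosets. Over the full group, the substitution x -> x h
  is a plain reindexing.\<close>

definition zeta_left :: "('k mat \<Rightarrow> 'a) \<Rightarrow> ('k mat \<Rightarrow> 'a) \<Rightarrow> 'a" where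
  "zeta_left f g = (\<Sum>x\<in>GL m. f (embed_tl n x) * g x)"

definition zeta_right :: "('k mat \<Rightarrow> 'a) \<Rightarrow> ('k mat \<Rightarrow> 'a) \<Rightarrow> 'a" where
  "zeta_right f g = (\<Sum>x\<in>GL m. \<Sum>y\<in>carrier_mat m (n - m - 1). f (gamma_mat n m x y) * g x)"

text \<open>For s > m the matrix \<open>embed_tl s x\<close> lies in P_s, so an element of U_{s+1}
  passes to the left of x without change of its character value.\<close>

lemma form_level_zeta_left: "form_level m zeta_left"
proof -
  have mn: "m \<le> n" using m_less by simp
  have "bilin zeta_left"
    by (simp add: bilin_def zeta_left_def fscale_def algebra_simps sum.distrib sum_distrib_left)
  moreover have "zeta_left (transl n (col_unip n s z) f) g = chi (z $ (s - 1)) * zeta_left f g"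
    if s: "m < s" "s < n" "z \<in> carrier_vec s" and f: "f \<in> W" for s z f g
  proof -
    have "transl n (col_unip n s z) f (embed_tl n x) = chi (z $ (s - 1)) * f (embed_tl n x)"
      if x: "x \<in> GL m" for x
    proof -
      have e: "embed_tl n (embed_tl s x) = embed_tl n x"
        using s by (intro embed_tl_embed_tl[OF GL_carrier[OF x]]) auto
      have G: "embed_tl n x \<in> GL n" using embed_tl_GL[OF x mn] .
      have "transl n (col_unip n s z) f (embed_tl n x) = f (embed_tl n x * col_unip n s z)"
        using G by (simp add: transl_def)
      also have "embed_tl n x * col_unip n s z = col_unip n s (embed_tl s x *\<^sub>v z) * embed_tl n x"
        using embed_tl_mult_col_unip[OF embed_tl_carrier s(3,2), of x] e by simp
      also have "f \<dots> = chi ((embed_tl s x *\<^sub>v z) $ (s - 1)) * f (embed_tl n x)"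
        using s by (intro w1.W_col_unip[OF f _ _ G]) auto
      also have "(embed_tl s x *\<^sub>v z) $ (s - 1) = z $ (s - 1)"
        by (rule embed_tl_mult_vec_last[OF s(1,3) GL_carrier[OF x]])
      finally show ?thesis .
    qed
    then show ?thesis by (simp add: zeta_left_def sum_distrib_left mult.assoc)
  qed
  moreover have "zeta_left (transl n (embed_tl n h) f) (transl m (embed_tl m h) g) = zeta_left f g"
    if h: "h \<in> GL m" for h f g
  proof -
    have "zeta_left (transl n (embed_tl n h) f) (transl m (embed_tl m h) g)
        = (\<Sum>x\<in>GL m. f (embed_tl n (x * h)) * g (x * h))"
      unfolding zeta_left_def using h mn
      by (intro sum.cong) (auto simp: transl_def embed_tl_GL embed_tl_self embed_tl_mult[of _ m] GL_carrier)
    also have "\<dots> = zeta_left f g" unfolding zeta_left_def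
      by (rule sum.reindex_bij_betw[OF GL_bij_right[OF h], of "\<lambda>x. f (embed_tl n x) * g x"])
    finally show ?thesis .
  qed
  \<comment> \<open>At level m the clauses on the second argument and on U_{m+1} are void, as they
    ask for m < s < m or m < m.\<close>
  ultimately show ?thesis by (simp add: form_level_def)
qed

text \<open>By \<open>gamma_mat_col_unip\<close> an element of U_{s+1} passes to the left, where W
  is equivariant, at the cost of a shear of y that the sum over all y absorbs.\<close>

lemma form_level_zeta_right: "form_level m zeta_right"
proof -
  let ?M = "carrier_mat m (n - m - 1) :: 'k mat set"
  have "bilin zeta_right"
    by (simp add: bilin_def zeta_right_def fscale_def algebra_simps sum.distrib sum_distrib_left)
  moreover have "zeta_right (transl n (col_unip n s z) f) g = chi (z $ (s - 1)) * zeta_right f g"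
    if s: "m < s" "s < n" "z \<in> carrier_vec s" and f: "f \<in> W" for s z f g
  proof -
    have "(\<Sum>y\<in>?M. transl n (col_unip n s z) f (gamma_mat n m x y) * g x)
        = (\<Sum>y\<in>?M. chi (z $ (s - 1)) * (f (gamma_mat n m x y) * g x))" if x: "x \<in> GL m" for x
    proof -
      have "transl n (col_unip n s z) f (gamma_mat n m x y)
          = chi (z $ (s - 1)) * f (gamma_mat n m x (shear n m x s z y))" for y
      proof -
        let ?z = "vec (s - m) (\<lambda>i. z $ (m + i))"
        have "transl n (col_unip n s z) f (gamma_mat n m x y) = f (gamma_mat n m x y * col_unip n s z)"
          using gamma_mat_GL(2)[OF x m_less] by (simp add: transl_def)
        also have "\<dots> = f (col_unip n (s - m) ?z * gamma_mat n m x (shear n m x s z y))"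
          by (simp only: gamma_mat_col_unip[OF s(1,2)])
        also have "\<dots> = chi (?z $ (s - m - 1)) * f (gamma_mat n m x (shear n m x s z y))"
          using s by (intro w1.W_col_unip[OF f _ _ gamma_mat_GL(2)[OF x m_less]]) auto
        also have "?z $ (s - m - 1) = z $ (m + (s - m - 1))" by (rule index_vec) (use s in simp)
        also have "m + (s - m - 1) = s - 1" using s by simp
        finally show ?thesis .
      qed
      then have "(\<Sum>y\<in>?M. transl n (col_unip n s z) f (gamma_mat n m x y) * g x)
          = (\<Sum>y\<in>?M. chi (z $ (s - 1)) * (f (gamma_mat n m x (shear n m x s z y)) * g x))"
        by (simp add: mult.assoc)
      also have "\<dots> = (\<Sum>y\<in>?M. chi (z $ (s - 1)) * (f (gamma_mat n m x y) * g x))"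
        by (rule sum.reindex_bij_betw[OF shear_bij[OF s(1,2)],
            of "\<lambda>y. chi (z $ (s - 1)) * (f (gamma_mat n m x y) * g x)"])
      finally show ?thesis .
    qed
    then show ?thesis by (simp add: zeta_right_def sum_distrib_left)
  qed
  moreover have "zeta_right (transl n (embed_tl n h) f) (transl m (embed_tl m h) g) = zeta_right f g"
    if h: "h \<in> GL m" for h f g
  proof -
    have "zeta_right (transl n (embed_tl n h) f) (transl m (embed_tl m h) g)
        = (\<Sum>x\<in>GL m. \<Sum>y\<in>?M. f (gamma_mat n m (x * h) y) * g (x * h))"
      unfolding zeta_right_def using h m_less gamma_mat_GL(2)
      by (intro sum.cong) (auto simp: transl_def embed_tl_self gamma_mat_embed_tl[of _ m] GL_carrier)
    also have "\<dots> = zeta_right f g" unfolding zeta_right_def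
      by (rule sum.reindex_bij_betw[OF GL_bij_right[OF h], of "\<lambda>x. \<Sum>y\<in>?M. f (gamma_mat n m x y) * g x"])
    finally show ?thesis .
  qed
  ultimately show ?thesis by (simp add: form_level_def)
qed

text \<open>The values of psi from W and of its inverse from W' cancel, so the summand is constant
  on cosets.\<close>

lemma sum_NG_zeta_left:
  assumes f: "f \<in> W" and g: "g \<in> W'"
  shows "of_nat (card (N_grp m :: 'k mat set)) * sum_NG m (\<lambda>x. f (embed_tl n x) * g x) = zeta_left f g"
  unfolding zeta_left_def
proof (rule sum_NG_eq_sum_GL)
  fix u x :: "'k mat" assume u: "u \<in> N_grp m" and x: "x \<in> GL m"
  have mn: "m \<le> n" using m_less by simp
  have "f (embed_tl n (u * x)) = f (embed_tl n u * embed_tl n x)"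
    by (simp add: embed_tl_mult[OF N_carrier[OF u] GL_carrier[OF x] mn])
  also have "\<dots> = psiN chi m u * f (embed_tl n x)"
    using w1.W_equiv[OF f _ embed_tl_GL[OF x mn]] embed_tl_N_iff[OF N_carrier[OF u] mn] u
    by (simp add: psiN_embed_tl[OF N_carrier[OF u] mn])
  finally have "f (embed_tl n (u * x)) * g (u * x)
      = (psiN (psi_inv chi) m u * psiN chi m u) * (f (embed_tl n x) * g x)"
    using w2.W_equiv[OF g u x] by (simp add: mult_ac)
  then show "f (embed_tl n (u * x)) * g (u * x) = f (embed_tl n x) * g x"
    by (simp add: w1.psiN_psi_inv)
qed

text \<open>The same cancellation, but N_m also moves y, so the invariance is that of the whole sum
  over y.\<close>

lemma sum_NG_zeta_right:
  assumes f: "f \<in> W" and g: "g \<in> W'"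
  shows "of_nat (card (N_grp m :: 'k mat set))
    * sum_NG m (\<lambda>x. \<Sum>y\<in>carrier_mat m (n - m - 1). f (gamma_mat n m x y) * g x) = zeta_right f g"
  unfolding zeta_right_def
proof (rule sum_NG_eq_sum_GL)
  let ?M = "carrier_mat m (n - m - 1) :: 'k mat set"
  fix u x :: "'k mat" assume u: "u \<in> N_grp m" and x: "x \<in> GL m"
  have "f (gamma_mat n m (u * x) (u * y)) * g (u * x) = f (gamma_mat n m x y) * g x" if y: "y \<in> ?M" for y
  proof -
    have "f (gamma_mat n m (u * x) (u * y)) = f (embed_br n m u * gamma_mat n m x y)"
      by (simp add: embed_br_gamma_mat[OF N_carrier[OF u] GL_carrier[OF x] y m_less])
    also have "\<dots> = psiN chi m u * f (gamma_mat n m x y)"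
      using w1.W_equiv[OF f embed_br_N[OF u] gamma_mat_GL(2)[OF x m_less]]
      by (simp add: psiN_embed_br[OF N_carrier[OF u] m_less])
    finally have "f (gamma_mat n m (u * x) (u * y)) * g (u * x)
        = (psiN (psi_inv chi) m u * psiN chi m u) * (f (gamma_mat n m x y) * g x)"
      using w2.W_equiv[OF g u x] by (simp add: mult_ac)
    then show ?thesis by (simp add: w1.psiN_psi_inv)
  qed
  then have "(\<Sum>y\<in>?M. f (gamma_mat n m (u * x) (u * y)) * g (u * x)) = (\<Sum>y\<in>?M. f (gamma_mat n m x y) * g x)"
    by simp
  moreover have "(\<Sum>y\<in>?M. f (gamma_mat n m (u * x) (u * y)) * g (u * x))
      = (\<Sum>y\<in>?M. f (gamma_mat n m (u * x) y) * g (u * x))"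
    by (rule sum.reindex_bij_betw[OF N_bij_mat[OF u], of "\<lambda>y. f (gamma_mat n m (u * x) y) * g (u * x)"])
  ultimately show "(\<Sum>y\<in>?M. f (gamma_mat n m (u * x) y) * g (u * x)) = (\<Sum>y\<in>?M. f (gamma_mat n m x y) * g x)"
    by simp
qed

context
  fixes f1 g1
  assumes f1: "f1 \<in> W" "f1 (1\<^sub>m n) = 1" "\<And>u. u \<in> N_grp n \<Longrightarrow> transl n u f1 = fscale (psiN chi n u) f1"
    and g1: "g1 \<in> W'" "g1 (1\<^sub>m m) = 1"
begin

lemma bessel_right: "u \<in> N_grp n \<Longrightarrow> x \<in> GL n \<Longrightarrow> f1 (x * u) = psiN chi n u * f1 x"
  using fun_cong[OF f1(3), of u x] by (simp add: transl_def fscale_def)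

text \<open>Since m < n, \<open>embed_tl n x\<close> has the last row of the identity, so the
  support of f1 leaves only x in N_m. There f1 and g1 take inverse values and each term is
  1.\<close>

lemma zeta_left_bessel: "zeta_left f1 g1 = of_nat (card (N_grp m :: 'k mat set))"
proof -
  have mn: "m \<le> n" using m_less by simp
  have "f1 (embed_tl n x) * g1 x = (if x \<in> N_grp m then 1 else 0)" if x: "x \<in> GL m" for x
  proof (cases "x \<in> N_grp m")
    case True
    have "embed_tl n x \<in> N_grp n" using embed_tl_N_iff[OF GL_carrier[OF x] mn] True by simp
    then have "f1 (embed_tl n x) = psiN chi m x"
      using w1.W_N[OF f1(1)] f1(2) by (simp add: psiN_embed_tl[OF GL_carrier[OF x] mn])
    moreover have "g1 x = psiN (psi_inv chi) m x" using w2.W_N[OF g1(1) True] g1(2) by simp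
    ultimately show ?thesis using True w1.psiN_psi_inv[of m x] by (simp add: mult.commute)
  next
    case False
    have G: "embed_tl n x \<in> GL n" using embed_tl_GL[OF x mn] .
    have "f1 (embed_tl n x) = 0"
    proof (rule ccontr)
      assume ne: "f1 (embed_tl n x) \<noteq> 0"
      have "embed_tl n x \<in> N_grp n"
      proof (rule w1.biequivariant_support_row[where f = f1, OF _ _ embed_tl_carrier _ ne])
        show "embed_tl n x $$ (n - 1, j) = (if j = n - 1 then 1 else 0)" if "j < n" for j
          using that m_less GL_carrier[OF x] by (auto simp: embed_tl_def)
      qed (use w1.W_equiv[OF f1(1) _ G] bessel_right[OF _ G] in auto)
      then show False using False embed_tl_N_iff[OF GL_carrier[OF x] mn] by simp
    qed
    then show ?thesis using False by simp
  qed
  then have "zeta_left f1 g1 = (\<Sum>x\<in>(GL m :: 'k mat set). if x \<in> N_grp m then 1 else 0)"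
    by (simp add: zeta_left_def)
  also have "\<dots> = (\<Sum>x\<in>(N_grp m :: 'k mat set). 1)"
    using N_GL finite_GL by (intro sum.mono_neutral_cong_right) auto
  finally show ?thesis by simp
qed

text \<open>The translation by \<open>block_swap\<close> gives the argument of f1 the first column
  of the identity. Its support then forces y = 0 and x in N_m, where the terms are 1 again.\<close>

lemma zeta_right_bessel:
  "zeta_right (transl n (block_swap n m) f1) g1 = of_nat (card (N_grp m :: 'k mat set))"
proof -
  let ?M = "carrier_mat m (n - m - 1) :: 'k mat set" and ?w = "block_swap n m :: 'k mat"
  obtain d where n: "n = d + m" and d: "0 < d" using m_less by (metis less_imp_add_positive add.commute)
  have "(\<Sum>y\<in>?M. transl n ?w f1 (gamma_mat n m x y) * g1 x) = (if x \<in> N_grp m then 1 else 0)"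
    if x: "x \<in> GL m" for x
  proof -
    have xc: "x \<in> carrier_mat m m" using GL_carrier[OF x] .
    have tr: "transl n ?w f1 (gamma_mat n m x y) = f1 (gamma_mat n m x y * ?w)" for y
      using gamma_mat_GL(2)[OF x m_less] by (simp add: transl_def)
    have supp: "x \<in> N_grp m \<and> y = 0\<^sub>m m (n - m - 1)"
      if y: "y \<in> ?M" and ne: "f1 (gamma_mat n m x y * ?w) \<noteq> 0" for y
    proof -
      let ?g = "gamma_mat n m x y * ?w"
      have G: "?g \<in> GL n" by (rule GL_mult[OF gamma_mat_GL(2)[OF x m_less] gamma_mat_GL(1)[OF x m_less]])
      have F: "?g = four_block_mat (1\<^sub>m d) (0\<^sub>m d m)
          (mat m d (\<lambda>(i,j). if j = 0 then 0 else y $$ (i, j - 1))) x"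
        using gamma_mat_block_swap[OF xc m_less, of y] by (simp add: n)
      have gN: "?g \<in> N_grp n"
      proof (rule w1.biequivariant_support_col[where f = f1, OF _ _ GL_carrier[OF G] _ ne])
        show "?g $$ (i,0) = (if i = 0 then 1 else 0)" if "i < n" for i
          unfolding F using that d xc n by auto
      qed (use w1.W_equiv[OF f1(1) _ G] bessel_right[OF _ G] in auto)
      have low: "?g $$ (i,j) = 0" if "j < i" "i < d + m" for i j using gN that by (simp add: N_grp_def n)
      have diag: "?g $$ (i,i) = 1" if "i < d + m" for i using gN that by (simp add: N_grp_def n)
      have "y $$ (i,j) = 0" if ij: "i < m" "j < d - 1" for i j
      proof -
        \<comment> \<open>Column 0 of the lower left block is zero, so column j of y stands in
          column j + 1, still to the left of x and below the diagonal.\<close>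
        have "Suc j < d" using ij by linarith
        then have "?g $$ (i + d, Suc j) = y $$ (i,j)" unfolding F using ij xc by simp
        moreover have "Suc j < i + d" "i + d < d + m" using ij by linarith+
        ultimately show ?thesis using low by simp
      qed
      then have "y = 0\<^sub>m m (n - m - 1)" using y by (intro eq_matI) (auto simp: n)
      moreover have "x $$ (i,i) = 1" if "i < m" for i using diag[of "i + d"] that xc unfolding F by simp
      moreover have "x $$ (i,j) = 0" if "i < m" "j < i" for i j
        using low[of "j + d" "i + d"] that xc unfolding F by simp
      ultimately show ?thesis using xc by (simp add: N_grp_def)
    qed
    show ?thesis
    proof (cases "x \<in> N_grp m")
      case True
      have "f1 (gamma_mat n m x y * ?w) = 0" if "y \<in> ?M" "y \<noteq> 0\<^sub>m m (n - m - 1)" for y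
        using supp[OF that(1)] that(2) by blast
      then have "(\<Sum>y\<in>?M. transl n ?w f1 (gamma_mat n m x y) * g1 x)
          = (\<Sum>y\<in>{0\<^sub>m m (n - m - 1)}. f1 (gamma_mat n m x y * ?w) * g1 x)"
        unfolding tr using finite_carrier_mat[of m "n - m - 1", where ?'k = 'k]
        by (intro sum.mono_neutral_right) auto
      also have "\<dots> = f1 (embed_br n m x) * g1 x"
        using gamma_mat_block_swap_zero[OF xc m_less] by simp
      also have "\<dots> = psiN chi m x * psiN (psi_inv chi) m x"
        using w1.W_N[OF f1(1) embed_br_N[OF True]] f1(2)
          w2.W_N[OF g1(1) True] g1(2) by (simp add: psiN_embed_br[OF xc m_less])
      finally show ?thesis using True w1.psiN_psi_inv[of m x] by (simp add: mult.commute)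
    next
      case False
      then have "f1 (gamma_mat n m x y * ?w) = 0" if "y \<in> ?M" for y using supp[OF that] by blast
      then show ?thesis using False by (simp add: tr)
    qed
  qed
  then have "zeta_right (transl n ?w f1) g1 = (\<Sum>x\<in>(GL m :: 'k mat set). if x \<in> N_grp m then 1 else 0)"
    by (simp add: zeta_right_def)
  also have "\<dots> = (\<Sum>x\<in>(N_grp m :: 'k mat set). 1)"
    using N_GL finite_GL by (intro sum.mono_neutral_cong_right) auto
  finally show ?thesis by simp
qed

end

theorem gamma_factor:
  assumes nex: "\<not> exceptional n m chi W W'"
  shows "\<exists>!\<gamma>. \<gamma> dvd 1 \<and> (\<forall>f\<in>W. \<forall>g\<in>W'.
     sum_NG m (\<lambda>x. f (embed_tl n x) * g x) * \<gamma>
     = sum_NG m (\<lambda>x. \<Sum>y\<in>carrier_mat m (n - m - 1). f (gamma_mat n m x y) * g x))"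
proof -
  let ?c = "of_nat (card (N_grp m :: 'k mat set)) :: 'a" and ?w = "block_swap n m :: 'k mat"
  obtain f1 where f1: "f1 \<in> W" "f1 (1\<^sub>m n) = 1" "\<And>u. u \<in> N_grp n \<Longrightarrow> transl n u f1 = fscale (psiN chi n u) f1"
    using w1.bessel_exists by blast
  obtain g1 where g1: "g1 \<in> W'" "g1 (1\<^sub>m m) = 1" using w2.W_value by blast
  have cu: "?c dvd 1" by (rule w1.card_N_unit)
  then obtain c' where c': "?c * c' = 1" by (auto simp: dvd_def)
  note left1 = zeta_left_bessel[OF f1 g1] and right1 = zeta_right_bessel[OF f1 g1]
  \<comment> \<open>The value forced by evaluation at (f1, g1), where \<open>zeta_left\<close> is
    |N_m|.\<close>
  define \<gamma> where "\<gamma> = c' * zeta_right f1 g1"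
  \<comment> \<open>D is again a form at level m, and it vanishes at (f1, g1), so
    \<open>form_vanish\<close> makes it zero.\<close>
  define D where "D f g = zeta_right f g - \<gamma> * zeta_left f g" for f g
  note L = form_level_zeta_left and R = form_level_zeta_right
  note bL = bilinD[OF form_levelD(1)[OF L]] and bR = bilinD[OF form_levelD(1)[OF R]]
  have "form_level m D"
    unfolding form_level_def bilin_def D_def
    using bL bR form_levelD(2,4)[OF L] form_levelD(2,4)[OF R]
    by (simp add: algebra_simps)
  moreover have "D f1 g1 = 0"
  proof -
    have "\<gamma> * zeta_left f1 g1 = (?c * c') * zeta_right f1 g1" by (simp only: \<gamma>_def left1 mult_ac)
    then show ?thesis using c' by (simp add: D_def)
  qed
  ultimately have "D f g = 0" if "f \<in> W" "g \<in> W'" for f g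
    using form_vanish[OF nex f1 g1 order_refl] that by blast
  then have eq: "zeta_right f g = \<gamma> * zeta_left f g" if "f \<in> W" "g \<in> W'" for f g
    using that by (simp add: D_def)
  have "1\<^sub>m m \<in> (GL m :: 'k mat set)" by simp
  then have wG: "?w \<in> GL n" using gamma_mat_GL(1) m_less by blast
  \<comment> \<open>At the translated Bessel function the right-hand side is the unit |N_m|, so
    \<gamma> divides a unit.\<close>
  have "?c = \<gamma> * zeta_left (transl n ?w f1) g1"
    using eq[OF w1.W_transl[OF f1(1) wG] g1(1)] right1 by simp
  then have unit: "\<gamma> dvd 1" using cu dvd_trans dvd_triv_left by metis
  show ?thesis
  proof (rule ex1I[of _ \<gamma>])
    show "\<gamma> dvd 1 \<and> (\<forall>f\<in>W. \<forall>g\<in>W'. sum_NG m (\<lambda>x. f (embed_tl n x) * g x) * \<gamma>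
       = sum_NG m (\<lambda>x. \<Sum>y\<in>carrier_mat m (n - m - 1). f (gamma_mat n m x y) * g x))"
    proof (intro conjI ballI unit)
      fix f g assume fg: "f \<in> W" "g \<in> W'"
      show "sum_NG m (\<lambda>x. f (embed_tl n x) * g x) * \<gamma>
       = sum_NG m (\<lambda>x. \<Sum>y\<in>carrier_mat m (n - m - 1). f (gamma_mat n m x y) * g x)"
      proof (rule unit_cancel_left[OF cu])
        have "?c * (sum_NG m (\<lambda>x. f (embed_tl n x) * g x) * \<gamma>) = \<gamma> * zeta_left f g"
          by (simp only: sum_NG_zeta_left[OF fg, symmetric] mult_ac)
        then show "?c * (sum_NG m (\<lambda>x. f (embed_tl n x) * g x) * \<gamma>)
          = ?c * sum_NG m (\<lambda>x. \<Sum>y\<in>carrier_mat m (n - m - 1). f (gamma_mat n m x y) * g x)"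
          using eq[OF fg] sum_NG_zeta_right[OF fg] by simp
      qed
    qed
  next
    fix \<delta> assume \<delta>: "\<delta> dvd 1 \<and> (\<forall>f\<in>W. \<forall>g\<in>W'. sum_NG m (\<lambda>x. f (embed_tl n x) * g x) * \<delta>
       = sum_NG m (\<lambda>x. \<Sum>y\<in>carrier_mat m (n - m - 1). f (gamma_mat n m x y) * g x))"
    \<comment> \<open>At (f1, g1) the left-hand sum is 1, so the right-hand side determines
      \<delta>.\<close>
    have "?c * sum_NG m (\<lambda>x. f1 (embed_tl n x) * g1 x) = ?c * 1"
      using sum_NG_zeta_left[OF f1(1) g1(1)] left1 by simp
    then have one: "sum_NG m (\<lambda>x. f1 (embed_tl n x) * g1 x) = 1" by (rule unit_cancel_left[OF cu])
    have "\<delta> = sum_NG m (\<lambda>x. \<Sum>y\<in>carrier_mat m (n - m - 1). f1 (gamma_mat n m x y) * g1 x)"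
      using bspec[OF bspec[OF conjunct2[OF \<delta>] f1(1)] g1(1)] one by simp
    then have "?c * \<delta> = zeta_right f1 g1" using sum_NG_zeta_right[OF f1(1) g1(1)] by simp
    moreover have "(?c * c') * \<delta> = c' * (?c * \<delta>)" by (simp only: mult_ac)
    ultimately have "(?c * c') * \<delta> = \<gamma>" by (simp only: \<gamma>_def)
    then show "\<delta> = \<gamma>" using c' by simp
  qed
qed

end

theorem theoremA:
  fixes p :: nat and \<zeta> :: "'a::comm_ring_1" and kk :: "'k::{field,finite} \<Rightarrow> nat"
    and n m :: nat
    and sc :: "'a \<Rightarrow> 'v::ab_group_add \<Rightarrow> 'v" and act :: "'k mat \<Rightarrow> 'v \<Rightarrow> 'v"
    and sc' :: "'a \<Rightarrow> 'w::ab_group_add \<Rightarrow> 'w" and act' :: "'k mat \<Rightarrow> 'w \<Rightarrow> 'w"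
    and l :: "'v \<Rightarrow> 'a" and l' :: "'w \<Rightarrow> 'a"
  assumes "prime p" and "of_nat p = (0::'k)"
    and "noetherian_ring TYPE('a)"
    and "Zp_zeta_algebra p \<zeta>"
    and "additive_mod p kk"
    and "1 \<le> m" and "m < n"
    and "GL_module n sc act" and "GL_module m sc' act'"
    and "whittaker_type n sc act (psiA \<zeta> kk)"
    and "whittaker_type m sc' act' (psiA \<zeta> kk)"
    and "whittaker_functional n sc act (psiA \<zeta> kk) l"
    and "whittaker_functional m sc' act' (psi_inv (psiA \<zeta> kk)) l'"
    and "\<not> exceptional n m (psiA \<zeta> kk) (whittaker_model n act l) (whittaker_model m act' l')"
  shows "\<exists>!\<gamma>::'a. \<gamma> dvd 1 \<and>
           (\<forall>W\<in>whittaker_model n act l. \<forall>W'\<in>whittaker_model m act' l'.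
              sum_NG m (\<lambda>x. W (embed_tl n x) * W' x) * \<gamma>
              = sum_NG m (\<lambda>x. \<Sum>y\<in>carrier_mat m (n - m - 1). W (gamma_mat n m x y) * W' x))"
proof -
  have chi: "additive_character (psiA \<zeta> kk)"
    using psiA_additive_character assms by blast
  have "whittaker_space (psiA \<zeta> kk) n (whittaker_model n act l)"
    using whittaker_model_space[OF chi] assms by blast
  moreover have "whittaker_space (psi_inv (psiA \<zeta> kk)) m (whittaker_model m act' l')"
    using whittaker_model_space[OF additive_character.psi_inv_character[OF chi]] assms by blast
  ultimately have "whittaker_pair (psiA \<zeta> kk) n m (whittaker_model n act l) (whittaker_model m act' l')"
    using assms by (simp add: whittaker_pair_def whittaker_pair_axioms_def)
  then show ?thesis by (rule whittaker_pair.gamma_factor) (rule assms)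
qed

end
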